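(* Let $\{y^\delta\}$ be a family of noisy data with $\delta:=\|y^\delta-y\|\to0$, and for each $y^\delta$ consider the dual gradient flow $$x(t)=\nabla\mathcal R^*(A^*\lambda(t)),\qquad \frac{d}{dt}\lambda(t)=y^\delta-Ax(t),\quad t>0,$$ with $\lambda(0)=0$. Assume there is a constant $\kappa>0$ such that $$\|y^\delta-Ax\|\ge\kappa\|y^\delta-y\|$$ for every $y^\delta$ in the family and every $x\in S(y^\delta):=\{x(t):t\ge0\}$, where $x(t)$ is produced by the flow using $y^\delta$. Fix $a>0$, let $\Theta(t,y^\delta):=(t+a)\|Ax(t)-y^\delta\|^2$ for $t\ge0$, and let $t_*:=t_*(y^\delta)\ge0$ be a number such that $$\Theta(t_*,y^\delta)=\min\{\Theta(t,y^\delta):t\ge0\}.$$ Then $$\mathcal R(x(t_* ))\to\mathcal R(x^\dagger)\quad\text{and}\quad D_{\mathcal R}^{\xi(t_* )}(x^\dagger,x(t_* ))\to0\qquad\text{as }\delta\to0,$$ where $\xi(t):=A^*\lambda(t)$. Consequently $\|x(t_* )-x^\dagger\|\to0$ as $\delta\to0$.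
   Context: Standing setting. $X$ is a Banach space, $Y$ is a Hilbert space (identified with its dual), $A:X\to Y$ is a bounded linear operator with adjoint $A^*:Y\to X^*$. $\mathcal R:X\to(-\infty,\infty]$ is proper, lower semi-continuous, and strongly convex in the sense that there is a constant $c_0>0$ with $$\mathcal R(\gamma x+(1-\gamma)x')+c_0\gamma(1-\gamma)\|x-x'\|^2\le\gamma\mathcal R(x)+(1-\gamma)\mathcal R(x')$$ for all $x,x'\in\mathrm{dom}(\mathcal R)$ and $0\le\gamma\le1$; moreover each sublevel set of $\mathcal R$ is weakly compact in $X$. Here $\mathrm{dom}(\mathcal R)=\{x:\mathcal R(x)<\infty\}$. The exact datum $y\in Y$ is such that $Ax=y$ has a solution in $\mathrm{dom}(\mathcal R)$. Under these assumptions there is a unique $\mathcal R$-minimizing solution $x^\dagger$, i.e. $Ax^\dagger=y$ and $\mathcal R(x^\dagger)=\min\{\mathcal R(x):x\in X,\ Ax=y\}$. Noise levels are positive, $\delta>0$; $x(t)$ and $\lambda(t)$ depend on $y^\delta$, although this is suppressed in the notation. $\mathcal R^*(\xi):=\sup_{x\in X}\{\langle\xi,x\rangle-\mathcal R(x)\}$, $\xi\in X^*$, is the Legendre–Fenchel conjugate. Under the assumptions $\mathcal R^*$ is finite and Fréchet differentiable on $X^*$, with $\nabla\mathcal R^*:X^*\to X$ Lipschitz continuous, and for any initial value $\lambda(0)\in Y$ the flow has a unique solution $(x,\lambda)\in C([0,\infty),X)\times C^1([0,\infty),Y)$. One has $A^*\lambda(t)\in\partial\mathcal R(x(t))$, where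 $\partial\mathcal R(x)=\{\xi\in X^*:\mathcal R(x')\ge\mathcal R(x)+\langle\xi,x'-x\rangle\ \forall x'\in X\}$. Bregman distance: for $\xi\in\partial\mathcal R(x)$, $D_{\mathcal R}^{\xi}(x',x):=\mathcal R(x')-\mathcal R(x)-\langle\xi,x'-x\rangle$. *)

theory Defs
  imports "HOL-Analysis.Analysis"
begin

text \<open>
  Extended real valued functionals have type \<open>'a \<Rightarrow> ereal\<close>; excluding the value
  \<open>- \<infinity>\<close> is part of \<open>proper_fun\<close>. The dual of a real normed space \<open>'a\<close> is the
  library type \<open>'a \<Rightarrow>\<^sub>L real\<close> with the operator norm.
\<close>

definition dom_fun :: "('a \<Rightarrow> ereal) \<Rightarrow> 'a set" where
  "dom_fun R = {x. R x < \<infinity>}"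

definition proper_fun :: "('a \<Rightarrow> ereal) \<Rightarrow> bool" where
  "proper_fun R \<longleftrightarrow> (\<forall>x. R x \<noteq> - \<infinity>) \<and> dom_fun R \<noteq> {}"

definition lower_semicontinuous :: "('a::topological_space \<Rightarrow> ereal) \<Rightarrow> bool" where
  "lower_semicontinuous R \<longleftrightarrow> (\<forall>x. R x \<le> Liminf (at x) R)"

definition strongly_convex :: "real \<Rightarrow> ('a::real_normed_vector \<Rightarrow> ereal) \<Rightarrow> bool" where
  "strongly_convex c R \<longleftrightarrow>
     (\<forall>x\<in>dom_fun R. \<forall>x'\<in>dom_fun R. \<forall>\<gamma>\<in>{0..1}.
        R (\<gamma> *\<^sub>R x + (1 - \<gamma>) *\<^sub>R x') + ereal (c * \<gamma> * (1 - \<gamma>) * (norm (x - x'))\<^sup>2)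
          \<le> ereal \<gamma> * R x + ereal (1 - \<gamma>) * R x')"

definition weak_topology :: "'a::real_normed_vector topology" where
  "weak_topology =
     topology_generated_by {blinfun_apply f -` U | (f :: 'a \<Rightarrow>\<^sub>L real) U. open U}"

text \<open>
  The adjoint takes values in the dual of \<open>'a\<close>, only the Hilbert space \<open>'b\<close> being
  identified with its dual: \<open>adj A v\<close> is the functional \<open>x \<mapsto> v \<bullet> A x\<close>. (The library
  constant \<open>adjoint\<close> requires an inner product on both spaces.)
\<close>

definition adj :: "('a::real_normed_vector \<Rightarrow>\<^sub>L 'b::real_inner) \<Rightarrow> 'b \<Rightarrow> ('a \<Rightarrow>\<^sub>L real)" where
  "adj A v = blinfun_inner_right v o\<^sub>L A"

definition conjugate :: "('a::real_normed_vector \<Rightarrow> ereal) \<Rightarrow> ('a \<Rightarrow>\<^sub>L real) \<Rightarrow> ereal" where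
  "conjugate R \<xi> = (SUP x. ereal (blinfun_apply \<xi> x) - R x)"

text \<open>
  The Frechet gradient at \<open>\<xi>\<close> of a functional on the dual of \<open>'a\<close>, as an element of \<open>'a\<close>:
  the \<open>x\<close> for which the derivative at \<open>\<xi>\<close> is the evaluation \<open>\<eta> \<mapsto> \<langle>\<eta>, x\<rangle>\<close>. It is unique if
  it exists, since the dual separates points. The functional is read as real valued; the
  conjugate of a proper, lower semicontinuous, strongly convex functional is finite everywhere.
\<close>

definition dual_gradient ::
    "(('a::real_normed_vector \<Rightarrow>\<^sub>L real) \<Rightarrow> ereal) \<Rightarrow> ('a \<Rightarrow>\<^sub>L real) \<Rightarrow> 'a" where
  "dual_gradient G \<xi> =
     (THE x. ((\<lambda>\<eta>. real_of_ereal (G \<eta>)) has_derivative (\<lambda>\<eta>. blinfun_apply \<eta> x)) (at \<xi>))"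

text \<open>
  Membership in \<open>C\<^sup>1([0,\<infinity>))\<close>; the derivative at \<open>0\<close> is one-sided.
\<close>

definition C1_half_line :: "(real \<Rightarrow> 'b::real_normed_vector) \<Rightarrow> bool" where
  "C1_half_line u \<longleftrightarrow>
     (\<exists>u'. continuous_on {0..} u' \<and>
           (\<forall>t\<ge>0. (u has_vector_derivative u' t) (at t within {0..})))"

definition dual_gradient_flow ::
    "('a::real_normed_vector \<Rightarrow>\<^sub>L 'b::real_inner) \<Rightarrow> ('a \<Rightarrow> ereal) \<Rightarrow> 'b
      \<Rightarrow> (real \<Rightarrow> 'a) \<Rightarrow> (real \<Rightarrow> 'b) \<Rightarrow> bool" where
  "dual_gradient_flow A R v x lam \<longleftrightarrow>
     continuous_on {0..} x \<and> C1_half_line lam \<and>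
     (\<forall>t>0. x t = dual_gradient (conjugate R) (adj A (lam t)) \<and>
            (lam has_vector_derivative (v - blinfun_apply A (x t))) (at t))"

text \<open>
  The Bregman distance of \<open>x'\<close> from \<open>x\<close> with respect to \<open>\<xi>\<close>; meaningful for \<open>\<xi>\<close> in the
  subdifferential of \<open>R\<close> at \<open>x\<close>, in which case \<open>R x\<close> is finite for proper \<open>R\<close>.
\<close>

definition bregman ::
    "('a::real_normed_vector \<Rightarrow> ereal) \<Rightarrow> ('a \<Rightarrow>\<^sub>L real) \<Rightarrow> 'a \<Rightarrow> 'a \<Rightarrow> ereal" where
  "bregman R \<xi> x' x = R x' - R x - ereal (blinfun_apply \<xi> (x' - x))"

end

theory Submission
  imports Defs
begin

text \<open>
  Write \<open>\<delta>\<close> for the noise level, \<open>r = \<parallel>A x(t\<^sub>*) - y\<^sup>\<delta>\<parallel>\<close> for the residual at the chosen time,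
  and \<open>\<Theta>\<^sub>*\<close> for the minimum \<open>(t\<^sub>* + a) r\<^sup>2\<close>. Two things are to be shown: \<open>\<Theta>\<^sub>* \<rightarrow> 0\<close>, and that this
  smallness forces convergence.

  Both rest on the dual problem, minimising \<open>R\<^sup>*(A\<^sup>*\<mu>) - \<langle>\<mu>, y\<rangle>\<close>, whose infimum is \<open>- R(x\<^sup>\<dagger>)\<close>
  (\<open>no_duality_gap\<close>). The infimum need not be attained, since no source condition is assumed; but
  for each \<open>\<epsilon> > 0\<close> there is some \<open>\<mu>\<close> within \<open>\<epsilon>\<close> of it. The flow is the gradient flow of the dual
  function for \<open>y\<^sup>\<delta>\<close>. Comparing the trajectory with such a \<open>\<mu>\<close> by the usual Lyapunov function of a
  convex gradient flow gives, whenever \<open>\<rho>\<close> bounds the squared residual from below on \<open>(0,T)\<close>,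
  \<open>T\<^sup>2 \<rho> + \<parallel>\<lambda>(T) - \<mu>\<parallel>\<^sup>2 \<le> \<parallel>\<mu>\<parallel>\<^sup>2 + 2 T (\<epsilon> + \<parallel>\<lambda>(T) - \<mu>\<parallel> \<delta>)\<close> (\<open>almost_optimal_estimate\<close>).

  For the first claim take \<open>\<rho> = \<Theta>\<^sub>* / (2 T)\<close> with \<open>T \<ge> a\<close>, which is a lower bound because \<open>\<Theta>\<^sub>*\<close>
  is a minimum: then \<open>\<Theta>\<^sub>* \<le> 2 \<parallel>\<mu>\<parallel>\<^sup>2 / T + 4 \<epsilon> + 2 T \<delta>\<^sup>2\<close>. Choosing first \<open>\<epsilon>\<close>, hence \<open>\<mu>\<close>, then \<open>T\<close>,
  and finally letting \<open>\<delta>\<close> tend to zero gives \<open>\<Theta>\<^sub>* \<rightarrow> 0\<close>.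

  For the second claim the noise condition \<open>r \<ge> \<kappa> \<delta>\<close> turns \<open>\<Theta>\<^sub>* \<rightarrow> 0\<close> into
  \<open>(t\<^sub>* + a) (\<delta> + r)\<^sup>2 \<rightarrow> 0\<close>. The estimate with \<open>\<rho> = 0\<close> bounds \<open>\<parallel>\<lambda>(t\<^sub>*)\<parallel>\<^sup>2\<close> by a constant plus multiples
  of \<open>t\<^sub>*\<close> and \<open>t\<^sub>*\<^sup>2 \<delta>\<^sup>2\<close>, so \<open>\<parallel>\<lambda>(t\<^sub>*)\<parallel> (\<delta> + r) \<rightarrow> 0\<close>; it does not matter whether \<open>t\<^sub>*\<close> stays
  bounded. As \<open>\<parallel>y - A x(t\<^sub>*)\<parallel> \<le> \<delta> + r\<close>, the pairing \<open>\<langle>\<lambda>(t\<^sub>*), y - A x(t\<^sub>*)\<rangle>\<close> tends to zero. It is the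
  difference between \<open>R(x\<^sup>\<dagger>) - R(x(t\<^sub>*))\<close> and the Bregman distance. The distance is nonnegative, so
  \<open>R(x(t\<^sub>*))\<close> is at most \<open>R(x\<^sup>\<dagger>) + o(1)\<close>; weak duality with an almost optimal \<open>\<mu>\<close> gives the reverse
  bound. Hence both limits, and strong convexity bounds the norm by the Bregman distance.

  The analysis of \<open>R\<close> uses its real part on its effective domain, for which strong convexity,
  closedness of the epigraph and completeness of the space make minimising sequences Cauchy. The
  gradient of \<open>R\<^sup>*\<close> is the resulting minimiser; that the gradient is uniquely determined by the
  derivative amounts to the dual space separating points, which is proved first.
\<close>

section \<open>Functionals separate points\<close>

text \<open>
  Below a sublinear functional \<open>p\<^sub>0\<close> there is, by Zorn's lemma, a minimal one, and a minimal sublinear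
  functional \<open>q\<close> is linear, since otherwise \<open>q\<close> could be lowered along some direction. Starting
  from a lowering of the norm along \<open>z\<close> makes the value of the functional at \<open>z\<close> nonzero.
\<close>

definition sublinear :: "('a::real_vector \<Rightarrow> real) \<Rightarrow> bool" where
  "sublinear p \<longleftrightarrow> (\<forall>x y. p (x + y) \<le> p x + p y) \<and> (\<forall>c x. 0 < c \<longrightarrow> p (c *\<^sub>R x) \<le> c * p x)"

lemma sublinear_add: "sublinear p \<Longrightarrow> p (x + y) \<le> p x + p y"
  and sublinear_scale_le: "sublinear p \<Longrightarrow> 0 < c \<Longrightarrow> p (c *\<^sub>R x) \<le> c * p x"
  by (auto simp: sublinear_def)

lemma sublinear_scale:
  assumes "sublinear p" "0 < c" shows "p (c *\<^sub>R x) = c * p x"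
proof (rule antisym)
  show "p (c *\<^sub>R x) \<le> c * p x" using assms by (rule sublinear_scale_le)
  have "p (inverse c *\<^sub>R c *\<^sub>R x) \<le> inverse c * p (c *\<^sub>R x)"
    using assms by (intro sublinear_scale_le) auto
  with assms(2) show "c * p x \<le> p (c *\<^sub>R x)"
    by (simp add: field_simps)
qed

lemma sublinear_zero: "sublinear p \<Longrightarrow> p 0 = 0"
  using sublinear_scale[of p 2 0] by simp

lemma sublinear_ge_uminus: "sublinear p \<Longrightarrow> - p (- x) \<le> p x"
  using sublinear_add[of p x "- x"] sublinear_zero[of p] by simp

text \<open>
  The sublinear functional obtained from \<open>p\<close> by lowering it just enough to make it linear on the ray
  through \<open>- u\<close> as well: its value at \<open>- u\<close> is \<open>- p u\<close>.
\<close>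
definition lower_along :: "'a::real_vector \<Rightarrow> ('a \<Rightarrow> real) \<Rightarrow> 'a \<Rightarrow> real" where
  "lower_along u p x = (INF t\<in>{0..}. p (x + t *\<^sub>R u) - t * p u)"

lemma lower_along_le:
  assumes p: "sublinear p" and "0 \<le> t"
  shows "lower_along u p x \<le> p (x + t *\<^sub>R u) - t * p u"
proof -
  have "- p (- x) \<le> p (x + s *\<^sub>R u) - s * p u" if "0 \<le> s" for s
  proof -
    have "s * p u = p (s *\<^sub>R u)"
      using that sublinear_scale[OF p] sublinear_zero[OF p] by (cases "s = 0") auto
    also have "\<dots> \<le> p (x + s *\<^sub>R u) + p (- x)"
      using sublinear_add[OF p, of "x + s *\<^sub>R u" "- x"] by simp
    finally show ?thesis by simp
  qed
  then have "bdd_below ((\<lambda>t. p (x + t *\<^sub>R u) - t * p u) ` {0..})"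
    by (intro bdd_belowI2) auto
  then show ?thesis
    unfolding lower_along_def using assms(2) by (intro cINF_lower) auto
qed

lemma lower_along_greatest:
  assumes "\<And>t. 0 \<le> t \<Longrightarrow> m \<le> p (x + t *\<^sub>R u) - t * p u"
  shows "m \<le> lower_along u p x"
  unfolding lower_along_def using assms by (intro cINF_greatest) auto

lemma sublinear_lower_along:
  assumes p: "sublinear p" shows "sublinear (lower_along u p)"
  unfolding sublinear_def
proof (intro conjI allI impI)
  fix x y
  have "lower_along u p (x + y) - (p (x + s *\<^sub>R u) - s * p u) \<le> p (y + t *\<^sub>R u) - t * p u"
    if "0 \<le> s" "0 \<le> t" for s t
  proof -
    have "lower_along u p (x + y) \<le> p ((x + y) + (s + t) *\<^sub>R u) - (s + t) * p u"
      using that by (intro lower_along_le p) auto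
    also have "(x + y) + (s + t) *\<^sub>R u = (x + s *\<^sub>R u) + (y + t *\<^sub>R u)"
      by (simp add: algebra_simps)
    also have "p \<dots> \<le> p (x + s *\<^sub>R u) + p (y + t *\<^sub>R u)"
      by (rule sublinear_add[OF p])
    finally show ?thesis by (simp add: algebra_simps)
  qed
  then have "lower_along u p (x + y) - (p (x + s *\<^sub>R u) - s * p u) \<le> lower_along u p y"
    if "0 \<le> s" for s using that by (intro lower_along_greatest) auto
  then have "lower_along u p (x + y) - lower_along u p y \<le> lower_along u p x"
    by (intro lower_along_greatest) (force simp: algebra_simps)
  then show "lower_along u p (x + y) \<le> lower_along u p x + lower_along u p y"
    by simp
next
  fix c :: real and x
  assume c: "0 < c"
  have "inverse c * lower_along u p (c *\<^sub>R x) \<le> p (x + t *\<^sub>R u) - t * p u" if "0 \<le> t" for t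
  proof -
    have "lower_along u p (c *\<^sub>R x) \<le> p (c *\<^sub>R x + (c * t) *\<^sub>R u) - (c * t) * p u"
      using that c by (intro lower_along_le p) auto
    also have "c *\<^sub>R x + (c * t) *\<^sub>R u = c *\<^sub>R (x + t *\<^sub>R u)"
      by (simp add: algebra_simps)
    also have "p \<dots> = c * p (x + t *\<^sub>R u)"
      by (rule sublinear_scale[OF p c])
    finally show ?thesis using c by (simp add: field_simps)
  qed
  then have "inverse c * lower_along u p (c *\<^sub>R x) \<le> lower_along u p x"
    by (intro lower_along_greatest) auto
  with c show "lower_along u p (c *\<^sub>R x) \<le> c * lower_along u p x"
    by (simp add: field_simps)
qed

text \<open>
  Sublinearity gives \<open>- p\<^sub>0 (- x) \<le> p x\<close> for every \<open>p \<le> p\<^sub>0\<close>, so a chain of such functionals has a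
  pointwise infimum. The infimum is subadditive because any two members of a chain are both above
  one of them.
\<close>
lemma exists_minimal_sublinear:
  fixes p0 :: "'a::real_vector \<Rightarrow> real"
  assumes p0: "sublinear p0"
  obtains q where "sublinear q" "q \<le> p0" "\<And>p. sublinear p \<Longrightarrow> p \<le> q \<Longrightarrow> p = q"
proof -
  define S where "S = {p. sublinear p \<and> p \<le> p0}"
  define P where "P = (\<lambda>p q :: 'a \<Rightarrow> real. q \<le> p)"
  have "\<exists>m\<in>S. \<forall>a\<in>S. P m a \<longrightarrow> a = m"
  proof (rule predicate_Zorn)
    show "partial_order_on S (relation_of P S)"
      by (auto simp: partial_order_on_def preorder_on_def relation_of_def P_def
          refl_on_def trans_def antisym_def)
  next
    fix C assume C: "C \<in> Chains (relation_of P S)"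
    then have CS: "C \<subseteq> S" and tot: "\<And>p q. p \<in> C \<Longrightarrow> q \<in> C \<Longrightarrow> p \<le> q \<or> q \<le> p"
      by (auto simp: Chains_def relation_of_def P_def)
    show "\<exists>u\<in>S. \<forall>a\<in>C. P a u"
    proof (cases "C = {}")
      case True
      then show ?thesis using p0 by (auto simp: S_def)
    next
      case False
      define q where "q x = (INF p\<in>C. p x)" for x
      have lower: "q x \<le> p x" if "p \<in> C" for p x
      proof -
        have "- p0 (- x) \<le> p x" if "p \<in> C" for p
          using sublinear_ge_uminus[of p x] CS that unfolding S_def
          by (force simp: le_fun_def intro: order_trans[rotated])
        then have "bdd_below ((\<lambda>p. p x) ` C)" by (intro bdd_belowI2) auto
        then show ?thesis unfolding q_def using that by (intro cINF_lower) auto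
      qed
      have greatest: "m \<le> q x" if "\<And>p. p \<in> C \<Longrightarrow> m \<le> p x" for m x
        unfolding q_def using False that by (intro cINF_greatest) auto
      have "sublinear q"
        unfolding sublinear_def
      proof (intro conjI allI impI)
        fix x y
        have "q (x + y) - p1 x \<le> p2 y" if p12: "p1 \<in> C" "p2 \<in> C" for p1 p2
        proof -
          obtain p where p: "p \<in> C" "p \<le> p1" "p \<le> p2"
            using tot[OF p12] p12 by blast
          have "q (x + y) \<le> p (x + y)" by (rule lower[OF p(1)])
          also have "\<dots> \<le> p x + p y" using p CS by (auto simp: S_def sublinear_def)
          also have "\<dots> \<le> p1 x + p2 y" using p by (auto simp: le_fun_def intro: add_mono)
          finally show ?thesis by simp
        qed
        then have "q (x + y) - p1 x \<le> q y" if "p1 \<in> C" for p1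
          using that by (intro greatest) auto
        then have "q (x + y) - q y \<le> q x"
          by (intro greatest) (force simp: algebra_simps)
        then show "q (x + y) \<le> q x + q y" by simp
      next
        fix c :: real and x
        assume c: "0 < c"
        have "inverse c * q (c *\<^sub>R x) \<le> p x" if "p \<in> C" for p
        proof -
          have "q (c *\<^sub>R x) \<le> c * p x"
            using lower[OF that] CS that c order_trans unfolding S_def
            by (blast dest: sublinear_scale_le)
          with c show ?thesis by (simp add: field_simps)
        qed
        then have "inverse c * q (c *\<^sub>R x) \<le> q x" by (rule greatest)
        with c show "q (c *\<^sub>R x) \<le> c * q x" by (simp add: field_simps)
      qed
      moreover have "q \<le> p0"
      proof -
        obtain p where "p \<in> C" using False by blast
        then show ?thesis using lower CS unfolding S_def le_fun_def
          by (blast intro: order_trans)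
      qed
      ultimately show ?thesis
        using lower by (auto simp: S_def P_def le_fun_def)
    qed
  qed
  then obtain q where "q \<in> S" "\<And>p. p \<in> S \<Longrightarrow> p \<le> q \<Longrightarrow> p = q"
    unfolding P_def by blast
  then show thesis
    using that order_trans unfolding S_def by blast
qed

text \<open>
  The minimal \<open>q\<close> equals each of its lowerings, and one step of lowering along \<open>u\<close> says
  \<open>q x \<le> q (x + u) - q u\<close>. Being below the norm lowered along \<open>z\<close>, it satisfies \<open>q (- z) \<le> - \<parallel>z\<parallel>\<close>.
\<close>
lemma blinfun_separates:
  fixes z :: "'a::real_normed_vector"
  assumes "z \<noteq> 0"
  shows "\<exists>f :: 'a \<Rightarrow>\<^sub>L real. blinfun_apply f z \<noteq> 0"
proof -
  have n: "sublinear (norm :: 'a \<Rightarrow> real)"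
    by (auto simp: sublinear_def norm_triangle_ineq)
  obtain q where q: "sublinear q" and q_le: "q \<le> lower_along z norm"
    and min: "\<And>p. sublinear p \<Longrightarrow> p \<le> q \<Longrightarrow> p = q"
    using exists_minimal_sublinear[OF sublinear_lower_along[OF n]] by blast
  have add: "q (x + u) = q x + q u" for x u
  proof (rule antisym)
    show "q (x + u) \<le> q x + q u" by (rule sublinear_add[OF q])
    have "lower_along u q \<le> q"
      using lower_along_le[OF q, of 0 u] by (auto simp: le_fun_def)
    then have "lower_along u q = q" by (rule min[OF sublinear_lower_along[OF q]])
    then show "q x + q u \<le> q (x + u)"
      using lower_along_le[OF q, of 1 u x] by simp
  qed
  have uminus: "q (- x) = - q x" for x
    using add[of x "- x"] sublinear_zero[OF q] by simp
  have scale: "q (c *\<^sub>R x) = c * q x" for c x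
  proof (cases c "0::real" rule: linorder_cases)
    case less
    then show ?thesis using sublinear_scale[OF q, of "- c" x] uminus[of "c *\<^sub>R x"] by simp
  qed (use sublinear_scale[OF q] sublinear_zero[OF q] in auto)
  have le_norm: "q x \<le> norm x" for x
    using q_le lower_along_le[OF n, of 0 z x] by (force simp: le_fun_def intro: order_trans)
  have bl: "bounded_linear q"
    by (rule bounded_linear_intro[where K = 1])
      (use add scale le_norm uminus[symmetric] in \<open>auto simp: abs_le_iff intro: order_trans[OF le_norm]\<close>)
  have "q (- z) \<le> - norm z"
    using q_le lower_along_le[OF n, of 1 z "- z"] by (force simp: le_fun_def intro: order_trans)
  then have "q z \<noteq> 0" using uminus[of z] assms by auto
  with bl show ?thesis by (metis bounded_linear_Blinfun_apply)
qed

section \<open>Strongly convex functions: minimisers and the conjugate\<close>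

text \<open>
  A proper, lower semicontinuous, strongly convex functional, given by its effective domain \<open>D\<close> and
  its real values there. Outside \<open>D\<close> the values of \<open>f\<close> carry no information. Lower semicontinuity
  including the boundary of \<open>D\<close> is expressed by closedness of the epigraph.
\<close>
locale closed_strongly_convex =
  fixes D :: "'a::banach set" and f :: "'a \<Rightarrow> real" and c :: real
  assumes nonempty: "D \<noteq> {}"
    and closed_epigraph: "closed {(z, m). z \<in> D \<and> f z \<le> m}"
    and strongly_convex_on: "\<And>x x' \<gamma>. x \<in> D \<Longrightarrow> x' \<in> D \<Longrightarrow> 0 \<le> \<gamma> \<Longrightarrow> \<gamma> \<le> 1 \<Longrightarrow>
       \<gamma> *\<^sub>R x + (1 - \<gamma>) *\<^sub>R x' \<in> D \<and>
       f (\<gamma> *\<^sub>R x + (1 - \<gamma>) *\<^sub>R x') + c * \<gamma> * (1 - \<gamma>) * (norm (x - x'))\<^sup>2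
         \<le> \<gamma> * f x + (1 - \<gamma>) * f x'"
    and c_pos: "0 < c"
begin

lemma epigraph_limit:
  assumes "\<And>n. u n \<in> D" "\<And>n. f (u n) \<le> m n" "u \<longlonglongrightarrow> x" "m \<longlonglongrightarrow> l"
  shows "x \<in> D \<and> f x \<le> l"
proof -
  have "(x, l) \<in> {(z, m). z \<in> D \<and> f z \<le> m}"
  proof (rule closed_sequentially[OF closed_epigraph])
    show "(\<lambda>n. (u n, m n)) \<longlonglongrightarrow> (x, l)"
      by (rule tendsto_Pair) fact+
    show "(u n, m n) \<in> {(z, m). z \<in> D \<and> f z \<le> m}" for n
      using assms(1,2) by simp
  qed
  then show ?thesis by simp
qed

text \<open>
  The epigraph misses a neighbourhood of \<open>(x\<^sub>0, f x\<^sub>0 - 1)\<close>, so \<open>f \<ge> f x\<^sub>0 - 1\<close> near \<open>x\<^sub>0\<close>. Convexity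
  propagates this local bound along rays from \<open>x\<^sub>0\<close> with at most linear loss, and the quadratic term
  of strong convexity outweighs a linear loss.
\<close>
lemma bounded_below: "\<exists>m. \<forall>z\<in>D. m \<le> f z"
proof -
  obtain x0 where x0: "x0 \<in> D" using nonempty by blast
  have "open (- {(z, m). z \<in> D \<and> f z \<le> m})" using closed_epigraph by auto
  moreover have "(x0, f x0 - 1) \<in> - {(z, m). z \<in> D \<and> f z \<le> m}" by simp
  ultimately obtain U V where UV: "open U" "open V" "(x0, f x0 - 1) \<in> U \<times> V"
      "U \<times> V \<subseteq> - {(z, m). z \<in> D \<and> f z \<le> m}"
    by (rule open_prod_elim)
  obtain e where e: "0 < e" "ball x0 e \<subseteq> U" using UV openE by blast
  define r where "r = e / 2"
  have r: "0 < r" using e by (simp add: r_def)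
  have near: "f x0 - 1 \<le> f z" if "z \<in> D" "norm (z - x0) \<le> r" for z
  proof -
    have "z \<in> U" using that e by (auto simp: r_def dist_norm norm_minus_commute subset_iff)
    then have "(z, f x0 - 1) \<in> - {(z, m). z \<in> D \<and> f z \<le> m}" using UV by blast
    then have "\<not> f z \<le> f x0 - 1" using that by simp
    then show ?thesis by linarith
  qed
  \<comment> \<open>At distance \<open>n > r\<close> the bound obtained is \<open>f x0 + c n\<^sup>2 - K n\<close>, whose minimum over \<open>n\<close> is \<open>f x0 - K\<^sup>2 / (4 c)\<close>.\<close>
  define K where "K = 1 / r + c * r"
  have far: "f x0 - K\<^sup>2 / (4 * c) \<le> f z" if z: "z \<in> D" "r < norm (z - x0)" for z
  proof -
    define n where "n = norm (z - x0)"
    define \<gamma> where "\<gamma> = r / n"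
    define w where "w = \<gamma> *\<^sub>R z + (1 - \<gamma>) *\<^sub>R x0"
    have n: "r < n" "0 < n" using z r by (auto simp: n_def)
    have \<gamma>: "0 < \<gamma>" "\<gamma> < 1" using n r by (auto simp: \<gamma>_def)
    have "w - x0 = \<gamma> *\<^sub>R (z - x0)" by (simp add: w_def algebra_simps)
    then have "norm (w - x0) = r" using \<gamma> n by (simp add: n_def[symmetric]) (simp add: \<gamma>_def)
    moreover have w: "w \<in> D \<and> f w + c * \<gamma> * (1 - \<gamma>) * n\<^sup>2 \<le> \<gamma> * f z + (1 - \<gamma>) * f x0"
      unfolding w_def n_def using strongly_convex_on[OF z(1) x0] \<gamma> by simp
    ultimately have "f x0 - 1 \<le> f w" using near by simp
    with w have "\<gamma> * (f x0 + c * (1 - \<gamma>) * n\<^sup>2) \<le> \<gamma> * f z + 1"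
      by (simp add: algebra_simps)
    then have "f x0 + c * (1 - \<gamma>) * n\<^sup>2 \<le> f z + 1 / \<gamma>"
      using \<gamma> by (simp add: field_simps)
    moreover have "c * (1 - \<gamma>) * n\<^sup>2 - 1 / \<gamma> = c * n\<^sup>2 - K * n"
      using n r by (simp add: \<gamma>_def K_def field_simps power2_eq_square)
    moreover have "0 \<le> c * (n - K / (2 * c))\<^sup>2" using c_pos by simp
    moreover have "c * (n - K / (2 * c))\<^sup>2 = c * n\<^sup>2 - K * n + K\<^sup>2 / (4 * c)"
      using c_pos by (simp add: field_simps power2_eq_square)
    ultimately show ?thesis by linarith
  qed
  have "min (f x0 - 1) (f x0 - K\<^sup>2 / (4 * c)) \<le> f z" if "z \<in> D" for z
    using near[OF that] far[OF that] by (cases "norm (z - x0) \<le> r") auto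
  then show ?thesis by blast
qed

text \<open>
  The value at the midpoint of two almost minimisers is at least the infimum, so strong convexity
  forces them to be close: minimising sequences are Cauchy. The quadratic growth follows by
  comparing the minimiser with points \<open>x + \<gamma> (z - x)\<close> and letting \<open>\<gamma>\<close> tend to zero.
\<close>
lemma minimizer_exists: "\<exists>x\<in>D. \<forall>z\<in>D. f x + c * (norm (z - x))\<^sup>2 \<le> f z"
proof -
  define I where "I = Inf (f ` D)"
  have bdd: "bdd_below (f ` D)" using bounded_below by (auto intro: bdd_belowI2)
  have I_le: "I \<le> f z" if "z \<in> D" for z
    unfolding I_def using bdd that by (rule cINF_lower)
  have "\<exists>z\<in>D. f z < I + inverse (real (Suc n))" for n
    using cInf_lessD[of "f ` D" "I + inverse (real (Suc n))"] nonempty by (auto simp: I_def)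
  then obtain u where u: "\<And>n. u n \<in> D" "\<And>n. f (u n) < I + inverse (real (Suc n))"
    by metis
  have mid: "c / 4 * (norm (u n - u k))\<^sup>2 \<le> (inverse (real (Suc n)) + inverse (real (Suc k))) / 2"
    for n k
  proof -
    define w where "w = (1/2) *\<^sub>R u n + (1 - 1/2) *\<^sub>R u k"
    have "w \<in> D" "f w + c * (1/2) * (1 - 1/2) * (norm (u n - u k))\<^sup>2
        \<le> 1/2 * f (u n) + (1 - 1/2) * f (u k)"
      unfolding w_def using strongly_convex_on[OF u(1)[of n] u(1)[of k], of "1/2"] by auto
    then show ?thesis using u(2)[of n] u(2)[of k] I_le[of w] by argo
  qed
  have "Cauchy u"
  proof (rule metric_CauchyI)
    fix e :: real assume e: "0 < e"
    then have "0 < c / 4 * e\<^sup>2" using c_pos by simp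
    then obtain N where N: "inverse (real (Suc N)) < c / 4 * e\<^sup>2"
      using reals_Archimedean by blast
    have "dist (u n) (u k) < e" if "N \<le> n" "N \<le> k" for n k
    proof -
      have "inverse (real (Suc n)) \<le> inverse (real (Suc N))"
           "inverse (real (Suc k)) \<le> inverse (real (Suc N))"
        using that by (auto intro!: le_imp_inverse_le)
      then have "c / 4 * (norm (u n - u k))\<^sup>2 < c / 4 * e\<^sup>2" using mid[of n k] N by argo
      then have "(norm (u n - u k))\<^sup>2 < e\<^sup>2" using c_pos by simp
      then show ?thesis using e by (simp add: dist_norm power_less_imp_less_base)
    qed
    then show "\<exists>M. \<forall>m\<ge>M. \<forall>n\<ge>M. dist (u m) (u n) < e" by blast
  qed
  then obtain x where lim: "u \<longlonglongrightarrow> x" using Cauchy_convergent convergent_def by blast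
  have "(\<lambda>n. I + inverse (real (Suc n))) \<longlonglongrightarrow> I + 0"
    by (intro tendsto_intros LIMSEQ_inverse_real_of_nat)
  then have x: "x \<in> D" "f x \<le> I"
    using epigraph_limit[OF u(1) less_imp_le[OF u(2)] lim] by auto
  have "f x + c * (norm (z - x))\<^sup>2 \<le> f z" if z: "z \<in> D" for z
  proof -
    have "f x + c * (1 - \<gamma>) * (norm (z - x))\<^sup>2 \<le> f z" if \<gamma>: "0 < \<gamma>" "\<gamma> < 1" for \<gamma>
    proof -
      have "f x + c * \<gamma> * (1 - \<gamma>) * (norm (z - x))\<^sup>2 \<le> \<gamma> * f z + (1 - \<gamma>) * f x"
        using strongly_convex_on[OF z x(1), of \<gamma>] \<gamma> x(2)
          I_le[of "\<gamma> *\<^sub>R z + (1 - \<gamma>) *\<^sub>R x"] by auto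
      then have "\<gamma> * (f x + c * (1 - \<gamma>) * (norm (z - x))\<^sup>2) \<le> \<gamma> * f z"
        by (simp add: algebra_simps)
      then show ?thesis using \<gamma> by simp
    qed
    then have "\<forall>\<^sub>F \<gamma> in at_right 0. f x + c * (1 - \<gamma>) * (norm (z - x))\<^sup>2 \<le> f z"
      by (auto simp: eventually_at_right_field intro!: exI[of _ 1])
    moreover have "((\<lambda>\<gamma>. f x + c * (1 - \<gamma>) * (norm (z - x))\<^sup>2)
        \<longlongrightarrow> f x + c * (1 - 0) * (norm (z - x))\<^sup>2) (at_right 0)"
      by (intro tendsto_intros)
    ultimately show ?thesis
      by (intro tendsto_upperbound[where F = "at_right (0::real)"]) auto
  qed
  with x show ?thesis by blast
qed

lemma add_convex:
  fixes h :: "'a \<Rightarrow> real"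
  assumes cont: "continuous_on UNIV h" and conv: "convex_on UNIV h"
  shows "closed_strongly_convex D (\<lambda>x. f x + h x) c"
proof
  have "closed ((\<lambda>(z, m). (z, m - h z)) -` {(z, m). z \<in> D \<and> f z \<le> m})"
    by (intro closed_vimage closed_epigraph)
      (auto simp: case_prod_unfold intro!: continuous_intros continuous_on_compose2[OF cont])
  also have "(\<lambda>(z, m). (z, m - h z)) -` {(z, m). z \<in> D \<and> f z \<le> m}
      = {(z, m). z \<in> D \<and> f z + h z \<le> m}"
    by auto
  finally show "closed {(z, m). z \<in> D \<and> f z + h z \<le> m}" .
next
  fix x x' \<gamma> assume *: "x \<in> D" "x' \<in> D" "0 \<le> \<gamma>" "\<gamma> \<le> (1::real)"
  have "h (\<gamma> *\<^sub>R x + (1 - \<gamma>) *\<^sub>R x') \<le> \<gamma> * h x + (1 - \<gamma>) * h x'"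
    using convex_onD[OF conv, of "1 - \<gamma>" x x'] * by simp
  then show "\<gamma> *\<^sub>R x + (1 - \<gamma>) *\<^sub>R x' \<in> D \<and>
      f (\<gamma> *\<^sub>R x + (1 - \<gamma>) *\<^sub>R x') + h (\<gamma> *\<^sub>R x + (1 - \<gamma>) *\<^sub>R x')
        + c * \<gamma> * (1 - \<gamma>) * (norm (x - x'))\<^sup>2
      \<le> \<gamma> * (f x + h x) + (1 - \<gamma>) * (f x' + h x')"
    using strongly_convex_on[OF *] by (simp add: algebra_simps)
qed (rule nonempty c_pos)+

text \<open>
  The maximiser of \<open>\<xi> - f\<close>, which turns out to be the gradient of the conjugate at \<open>\<xi>\<close>.
\<close>
definition primal_point :: "('a \<Rightarrow>\<^sub>L real) \<Rightarrow> 'a" where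
  "primal_point \<xi> = (SOME x. x \<in> D \<and>
     (\<forall>z\<in>D. f x + blinfun_apply \<xi> (z - x) + c * (norm (z - x))\<^sup>2 \<le> f z))"

lemma primal_point:
  shows primal_point_in: "primal_point \<xi> \<in> D"
    and primal_point_growth: "z \<in> D \<Longrightarrow> f (primal_point \<xi>)
      + blinfun_apply \<xi> (z - primal_point \<xi>) + c * (norm (z - primal_point \<xi>))\<^sup>2 \<le> f z"
proof -
  interpret J: closed_strongly_convex D "\<lambda>x. f x + - blinfun_apply \<xi> x" c
  proof (rule add_convex)
    show "continuous_on UNIV (\<lambda>x. - blinfun_apply \<xi> x)" by (intro continuous_intros)
    show "convex_on UNIV (\<lambda>x. - blinfun_apply \<xi> x)"
      by (auto simp: convex_on_def blinfun.bilinear_simps)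
  qed
  obtain x where "x \<in> D"
    "\<forall>z\<in>D. f x + - blinfun_apply \<xi> x + c * (norm (z - x))\<^sup>2 \<le> f z + - blinfun_apply \<xi> z"
    using J.minimizer_exists by blast
  then have "\<exists>x. x \<in> D \<and>
     (\<forall>z\<in>D. f x + blinfun_apply \<xi> (z - x) + c * (norm (z - x))\<^sup>2 \<le> f z)"
    by (intro exI[of _ x]) (auto simp: blinfun.diff_right algebra_simps)
  from someI_ex[OF this, folded primal_point_def]
  show "primal_point \<xi> \<in> D" "z \<in> D \<Longrightarrow> f (primal_point \<xi>)
      + blinfun_apply \<xi> (z - primal_point \<xi>) + c * (norm (z - primal_point \<xi>))\<^sup>2 \<le> f z"
    by auto
qed

text \<open>
  Adding the growth inequalities at the two points shows that the inverse of this map is strongly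
  monotone with constant \<open>2 c\<close>.
\<close>
lemma primal_point_lipschitz:
  "norm (primal_point \<xi> - primal_point \<eta>) \<le> norm (\<xi> - \<eta>) / (2 * c)"
proof -
  define x y where "x = primal_point \<xi>" and "y = primal_point \<eta>"
  have "2 * c * (norm (x - y))\<^sup>2 \<le> blinfun_apply (\<xi> - \<eta>) (x - y)"
    using primal_point_growth[OF primal_point_in, of \<xi> \<eta>]
      primal_point_growth[OF primal_point_in, of \<eta> \<xi>]
    by (simp add: x_def y_def norm_minus_commute blinfun.bilinear_simps algebra_simps)
  also have "\<dots> \<le> norm (\<xi> - \<eta>) * norm (x - y)"
    using norm_blinfun[of "\<xi> - \<eta>" "x - y"] by simp
  finally have *: "(2 * c * norm (x - y)) * norm (x - y) \<le> norm (\<xi> - \<eta>) * norm (x - y)"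
    by (simp add: power2_eq_square mult.assoc)
  have "2 * c * norm (x - y) \<le> norm (\<xi> - \<eta>)"
  proof (cases "x = y")
    case False
    then show ?thesis using * by (intro mult_right_le_imp_le[OF *]) simp
  qed simp
  then show ?thesis using c_pos unfolding x_def y_def by (simp add: field_simps)
qed

lemma continuous_on_primal_point: "continuous_on S primal_point"
  by (rule lipschitz_on_continuous_on[of "1 / (2 * c)"])
    (use primal_point_lipschitz c_pos in \<open>auto simp: lipschitz_on_def dist_norm\<close>)

definition conj_fun :: "('a \<Rightarrow>\<^sub>L real) \<Rightarrow> real" where
  "conj_fun \<xi> = blinfun_apply \<xi> (primal_point \<xi>) - f (primal_point \<xi>)"

lemma fenchel_young: "z \<in> D \<Longrightarrow> blinfun_apply \<xi> z - f z \<le> conj_fun \<xi>"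
  using primal_point_growth[of z \<xi>]
    mult_nonneg_nonneg[OF less_imp_le[OF c_pos] zero_le_power2[of "norm (z - primal_point \<xi>)"]]
  unfolding conj_fun_def blinfun.diff_right by linarith

lemma conj_fun_subgradient:
  "conj_fun \<xi> + blinfun_apply (\<eta> - \<xi>) (primal_point \<xi>) \<le> conj_fun \<eta>"
  using fenchel_young[OF primal_point_in, of \<eta> \<xi>]
  by (simp add: conj_fun_def blinfun.diff_left)

text \<open>
  Each primal point provides an affine minorant of the conjugate that touches it. The minorants at
  \<open>\<xi>\<close> and \<open>\<eta>\<close> enclose the linearisation error between \<open>0\<close> and
  \<open>\<langle>\<eta> - \<xi>, primal_point \<eta> - primal_point \<xi>\<rangle>\<close>, which is quadratic by the Lipschitz bound.
\<close>
lemma conj_fun_has_derivative: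
  "(conj_fun has_derivative (\<lambda>\<eta>. blinfun_apply \<eta> (primal_point \<xi>))) (at \<xi>)"
proof (rule has_derivativeI_sandwich[where e = 1])
  show "bounded_linear (\<lambda>\<eta>. blinfun_apply \<eta> (primal_point \<xi>))"
    by (rule blinfun.bounded_linear_left)
  fix \<eta> assume "\<eta> \<in> UNIV" "\<eta> \<noteq> \<xi>" "dist \<eta> \<xi> < 1"
  have "0 \<le> conj_fun \<eta> - conj_fun \<xi> - blinfun_apply (\<eta> - \<xi>) (primal_point \<xi>)"
    using conj_fun_subgradient[of \<xi> \<eta>] by simp
  moreover have "conj_fun \<eta> - conj_fun \<xi> - blinfun_apply (\<eta> - \<xi>) (primal_point \<xi>)
      \<le> blinfun_apply (\<eta> - \<xi>) (primal_point \<eta> - primal_point \<xi>)"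
    using conj_fun_subgradient[of \<eta> \<xi>] by (simp add: blinfun.bilinear_simps)
  moreover have "\<dots> \<le> norm (\<eta> - \<xi>) * (norm (\<eta> - \<xi>) / (2 * c))"
    using norm_blinfun[of "\<eta> - \<xi>" "primal_point \<eta> - primal_point \<xi>"]
      mult_left_mono[OF primal_point_lipschitz[of \<eta> \<xi>] norm_ge_zero[of "\<eta> - \<xi>"]]
    by simp
  ultimately have "norm (conj_fun \<eta> - conj_fun \<xi> - blinfun_apply (\<eta> - \<xi>) (primal_point \<xi>))
      \<le> norm (\<eta> - \<xi>) * (norm (\<eta> - \<xi>) / (2 * c))" by simp
  then show "norm (conj_fun \<eta> - conj_fun \<xi> - blinfun_apply (\<eta> - \<xi>) (primal_point \<xi>))
      / norm (\<eta> - \<xi>) \<le> norm (\<eta> - \<xi>) / (2 * c)"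
    using \<open>\<eta> \<noteq> \<xi>\<close> by (simp add: pos_divide_le_eq mult.commute)
next
  have "((\<lambda>\<eta>. norm (\<eta> - \<xi>) / (2 * c)) \<longlongrightarrow> norm (\<xi> - \<xi>) / (2 * c)) (at \<xi>)"
    using c_pos by (intro tendsto_intros) auto
  then show "((\<lambda>\<eta>. norm (\<eta> - \<xi>) / (2 * c)) \<longlongrightarrow> 0) (at \<xi>)" by simp
qed auto

end

section \<open>Absence of a duality gap\<close>

lemma adj_apply [simp]: "blinfun_apply (adj A v) x = v \<bullet> blinfun_apply A x"
  by (simp add: adj_def)

lemma bounded_linear_adj: "bounded_linear (adj A)"
  unfolding adj_def
  by (rule bounded_linear_compose[OF bounded_bilinear.bounded_linear_left[OF bounded_bilinear_blinfun_compose]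
        bounded_linear_blinfun_inner_right])

context closed_strongly_convex
begin

lemma weak_duality:
  "z \<in> D \<Longrightarrow> \<nu> \<bullet> blinfun_apply A z - f z \<le> conj_fun (adj A \<nu>)"
  using fenchel_young[of z "adj A \<nu>"] by simp

text \<open>
  Minimising \<open>f + s/2 \<parallel>A \<cdot> - y\<parallel>\<^sup>2\<close> yields a dual candidate for free: the first order condition at the
  minimiser \<open>x\<close> says that \<open>x\<close> maximises \<open>\<langle>\<nu>, A \<cdot>\<rangle> - f\<close> for \<open>\<nu> = s (y - A x)\<close>, so the conjugate at
  \<open>adj A \<nu>\<close> is known.
\<close>
lemma penalized_minimizer:
  fixes A :: "'a \<Rightarrow>\<^sub>L 'b::real_inner" and y :: 'b and s :: real
  assumes s: "0 \<le> s"
  obtains x where "x \<in> D"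
    and "\<And>z. z \<in> D \<Longrightarrow> f x + s / 2 * (norm (blinfun_apply A x - y))\<^sup>2 + c * (norm (z - x))\<^sup>2
           \<le> f z + s / 2 * (norm (blinfun_apply A z - y))\<^sup>2"
    and "conj_fun (adj A (s *\<^sub>R (y - blinfun_apply A x)))
           \<le> (s *\<^sub>R (y - blinfun_apply A x)) \<bullet> blinfun_apply A x - f x"
proof -
  define h where "h z = s / 2 * (norm (blinfun_apply A z - y))\<^sup>2" for z
  have expand: "h (x + \<gamma> *\<^sub>R w) = h x + \<gamma> * (s * ((blinfun_apply A x - y) \<bullet> blinfun_apply A w))
      + \<gamma>\<^sup>2 * (s / 2 * (norm (blinfun_apply A w))\<^sup>2)" for x w \<gamma>
    unfolding h_def power2_norm_eq_inner
    by (simp add: blinfun.bilinear_simps algebra_simps inner_commute power2_eq_square)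
  have "convex_on UNIV h"
  proof (rule convex_onI)
    fix t :: real and x x' :: 'a assume t: "0 < t" "t < 1"
    define w where "w = x' - x"
    define p where "p = s * ((blinfun_apply A x - y) \<bullet> blinfun_apply A w)"
    define q where "q = s / 2 * (norm (blinfun_apply A w))\<^sup>2"
    have hx': "h x' = h x + p + q"
      using expand[of x 1 w] by (simp add: w_def p_def q_def)
    have "t\<^sup>2 \<le> t" using t by (simp add: power2_eq_square mult_left_le)
    then have "t\<^sup>2 * q \<le> t * q" using s by (intro mult_right_mono) (auto simp: q_def)
    moreover have "(1 - t) *\<^sub>R x + t *\<^sub>R x' = x + t *\<^sub>R w" by (simp add: w_def algebra_simps)
    moreover have "h (x + t *\<^sub>R w) = h x + t * p + t\<^sup>2 * q"
      using expand[of x t w] by (simp only: p_def q_def)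
    ultimately show "h ((1 - t) *\<^sub>R x + t *\<^sub>R x') \<le> (1 - t) * h x + t * h x'"
      unfolding hx' by (simp add: algebra_simps)
  qed simp
  moreover have "continuous_on UNIV h" unfolding h_def by (intro continuous_intros)
  ultimately interpret J: closed_strongly_convex D "\<lambda>z. f z + h z" c
    by (intro add_convex)
  obtain x where x: "x \<in> D" and min: "\<And>z. z \<in> D \<Longrightarrow> f x + h x + c * (norm (z - x))\<^sup>2 \<le> f z + h z"
    using J.minimizer_exists by blast
  define \<nu> where "\<nu> = s *\<^sub>R (y - blinfun_apply A x)"
  have optimal: "\<nu> \<bullet> blinfun_apply A z - f z \<le> \<nu> \<bullet> blinfun_apply A x - f x" if z: "z \<in> D" for z
  proof -
    define w where "w = z - x"
    define q where "q = s / 2 * (norm (blinfun_apply A w))\<^sup>2"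
    have "0 \<le> f z - f x - \<nu> \<bullet> blinfun_apply A w + \<gamma> * q" if \<gamma>: "0 < \<gamma>" "\<gamma> < 1" for \<gamma>
    proof -
      have eq: "\<gamma> *\<^sub>R z + (1 - \<gamma>) *\<^sub>R x = x + \<gamma> *\<^sub>R w" by (simp add: w_def algebra_simps)
      have "x + \<gamma> *\<^sub>R w \<in> D"
        and "f (x + \<gamma> *\<^sub>R w) + c * \<gamma> * (1 - \<gamma>) * (norm (z - x))\<^sup>2 \<le> \<gamma> * f z + (1 - \<gamma>) * f x"
        using strongly_convex_on[OF z x, of \<gamma>] \<gamma> unfolding eq by auto
      moreover have "0 \<le> c * \<gamma> * (1 - \<gamma>) * (norm (z - x))\<^sup>2" using \<gamma> c_pos by simp
      moreover have "f x + h x \<le> f (x + \<gamma> *\<^sub>R w) + h (x + \<gamma> *\<^sub>R w)"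
        using min[OF \<open>x + \<gamma> *\<^sub>R w \<in> D\<close>]
          mult_nonneg_nonneg[OF less_imp_le[OF c_pos] zero_le_power2[of "norm (x + \<gamma> *\<^sub>R w - x)"]]
        by linarith
      moreover have "h (x + \<gamma> *\<^sub>R w) = h x - \<gamma> * (\<nu> \<bullet> blinfun_apply A w) + \<gamma>\<^sup>2 * q"
        unfolding expand q_def \<nu>_def by (simp add: inner_diff_left algebra_simps)
      ultimately have "0 \<le> \<gamma> * f z + (1 - \<gamma>) * f x - f x - \<gamma> * (\<nu> \<bullet> blinfun_apply A w) + \<gamma>\<^sup>2 * q"
        by linarith
      also have "\<dots> = \<gamma> * (f z - f x - \<nu> \<bullet> blinfun_apply A w + \<gamma> * q)"
        by (simp add: algebra_simps power2_eq_square)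
      finally show ?thesis using \<gamma> by (simp add: zero_le_mult_iff)
    qed
    then have "\<forall>\<^sub>F \<gamma> in at_right 0. 0 \<le> f z - f x - \<nu> \<bullet> blinfun_apply A w + \<gamma> * q"
      by (auto simp: eventually_at_right_field intro!: exI[of _ 1])
    moreover have "((\<lambda>\<gamma>. f z - f x - \<nu> \<bullet> blinfun_apply A w + \<gamma> * q)
        \<longlongrightarrow> f z - f x - \<nu> \<bullet> blinfun_apply A w + 0 * q) (at_right 0)"
      by (intro tendsto_intros)
    ultimately have "0 \<le> f z - f x - \<nu> \<bullet> blinfun_apply A w + 0 * q"
      by (intro tendsto_lowerbound[where F = "at_right (0::real)"]) auto
    then show ?thesis by (simp add: w_def blinfun.bilinear_simps inner_diff_right)
  qed
  show thesis
  proof (rule that[OF x])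
    show "f x + s / 2 * (norm (blinfun_apply A x - y))\<^sup>2 + c * (norm (z - x))\<^sup>2
           \<le> f z + s / 2 * (norm (blinfun_apply A z - y))\<^sup>2" if "z \<in> D" for z
      using min[OF that] by (simp add: h_def)
    show "conj_fun (adj A (s *\<^sub>R (y - blinfun_apply A x)))
           \<le> (s *\<^sub>R (y - blinfun_apply A x)) \<bullet> blinfun_apply A x - f x"
      using optimal[OF primal_point_in, of "adj A \<nu>"]
      by (simp add: conj_fun_def \<nu>_def)
  qed
qed

text \<open>
  For the penalised minimisers \<open>u n\<close> with weight \<open>n\<close>, the minimal values \<open>m n\<close> increase and are
  bounded by \<open>f xd\<close>. By strong convexity the squared distance of two minimisers is controlled by the
  difference of their minimal values, so \<open>u\<close> converges. The limit satisfies the constraint and,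
  the epigraph being closed, has value at most \<open>lim m\<close>, whence \<open>m n\<close> increases to \<open>f xd\<close>. The multiplier belonging to \<open>u n\<close> has dual value at least \<open>m n\<close>.
\<close>
lemma no_duality_gap:
  fixes A :: "'a \<Rightarrow>\<^sub>L 'b::real_inner" and y :: 'b
  assumes xd: "xd \<in> D" "blinfun_apply A xd = y"
    and xd_min: "\<And>z. z \<in> D \<Longrightarrow> blinfun_apply A z = y \<Longrightarrow> f xd \<le> f z"
    and \<epsilon>: "0 < \<epsilon>"
  shows "\<exists>\<mu>. conj_fun (adj A \<mu>) \<le> \<mu> \<bullet> y - f xd + \<epsilon>"
proof -
  define r where "r z = norm (blinfun_apply A z - y)" for z
  have "\<forall>n. \<exists>x. x \<in> D \<and>
      (\<forall>z\<in>D. f x + real n / 2 * (r x)\<^sup>2 + c * (norm (z - x))\<^sup>2 \<le> f z + real n / 2 * (r z)\<^sup>2) \<and>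
      conj_fun (adj A (real n *\<^sub>R (y - blinfun_apply A x)))
        \<le> (real n *\<^sub>R (y - blinfun_apply A x)) \<bullet> blinfun_apply A x - f x"
    unfolding r_def by (metis penalized_minimizer of_nat_0_le_iff)
  then obtain u where u: "\<And>n. u n \<in> D"
    and min: "\<And>n z. z \<in> D \<Longrightarrow> f (u n) + real n / 2 * (r (u n))\<^sup>2 + c * (norm (z - u n))\<^sup>2
                \<le> f z + real n / 2 * (r z)\<^sup>2"
    and dual: "\<And>n. conj_fun (adj A (real n *\<^sub>R (y - blinfun_apply A (u n))))
        \<le> (real n *\<^sub>R (y - blinfun_apply A (u n))) \<bullet> blinfun_apply A (u n) - f (u n)"
    by metis
  define m where "m n = f (u n) + real n / 2 * (r (u n))\<^sup>2" for n
  have sq_nonneg: "0 \<le> c * (norm z)\<^sup>2" for z :: 'a using c_pos by simp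
  have m_le: "m n \<le> f xd" for n
    using min[OF xd(1), of n] sq_nonneg[of "xd - u n"] by (simp add: m_def r_def xd(2))
  have step: "m n + c * (norm (u k - u n))\<^sup>2 \<le> m k" if "n \<le> k" for n k
  proof -
    have "real n / 2 * (r (u k))\<^sup>2 \<le> real k / 2 * (r (u k))\<^sup>2"
      using that by (intro mult_right_mono) auto
    then show ?thesis using min[OF u, of n k] by (simp add: m_def)
  qed
  have "incseq m"
  proof (rule monoI)
    fix n k :: nat assume "n \<le> k"
    then show "m n \<le> m k" using step[of n k] sq_nonneg[of "u k - u n"] by linarith
  qed
  then obtain l where l: "m \<longlonglongrightarrow> l" "\<And>n. m n \<le> l"
    using incseq_convergent[of m "f xd"] m_le by blast
  have "Cauchy u"
  proof (rule metric_CauchyI)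
    fix e :: real assume e: "0 < e"
    have "0 < c * e\<^sup>2" using e c_pos by simp
    then have "\<forall>\<^sub>F n in sequentially. l - c * e\<^sup>2 < m n"
      using order_tendstoD(1)[OF l(1), of "l - c * e\<^sup>2"] by simp
    then obtain N where N: "\<And>n. N \<le> n \<Longrightarrow> l - c * e\<^sup>2 < m n"
      by (auto simp: eventually_sequentially)
    have ord: "dist (u k) (u n) < e" if "N \<le> n" "n \<le> k" for n k
    proof -
      have "c * (norm (u k - u n))\<^sup>2 < c * e\<^sup>2"
        using step[OF that(2)] N[OF that(1)] l(2)[of k] by linarith
      then have "(norm (u k - u n))\<^sup>2 < e\<^sup>2" using c_pos by simp
      then show ?thesis using e by (simp add: dist_norm power_less_imp_less_base)
    qed
    have "dist (u k) (u n) < e" if "N \<le> n" "N \<le> k" for n k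
      using ord[of n k] ord[of k n] that by (cases "n \<le> k") (auto simp: dist_commute)
    then show "\<exists>M. \<forall>m\<ge>M. \<forall>n\<ge>M. dist (u m) (u n) < e" by blast
  qed
  then obtain x where x: "u \<longlonglongrightarrow> x" using Cauchy_convergent convergent_def by blast
  obtain b where b: "\<And>z. z \<in> D \<Longrightarrow> b \<le> f z" using bounded_below by blast
  have res: "(r (u n))\<^sup>2 \<le> 2 * (f xd - b) * inverse (real n)" if "0 < n" for n
    using m_le[of n] b[OF u[of n]] that by (simp add: m_def field_simps)
  have "(\<lambda>n. 2 * (f xd - b) * inverse (real n)) \<longlonglongrightarrow> 2 * (f xd - b) * 0"
    by (intro tendsto_intros lim_inverse_n)
  moreover have "(\<lambda>n. (r (u n))\<^sup>2) \<longlonglongrightarrow> (r x)\<^sup>2"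
    unfolding r_def by (intro tendsto_intros x)
  moreover have "\<exists>N. \<forall>n\<ge>N. (r (u n))\<^sup>2 \<le> 2 * (f xd - b) * inverse (real n)"
    using res by (intro exI[of _ 1]) auto
  ultimately have "(r x)\<^sup>2 \<le> 2 * (f xd - b) * 0"
    by (intro LIMSEQ_le)
  then have "blinfun_apply A x = y" by (simp add: r_def)
  moreover have "x \<in> D \<and> f x \<le> l"
    by (rule epigraph_limit[OF u _ x l(1)]) (simp add: m_def)
  ultimately have "f xd \<le> l" using xd_min by force
  then obtain n where n: "f xd - \<epsilon> < m n"
    using order_tendstoD(1)[OF l(1), of "f xd - \<epsilon>"] \<epsilon> by (auto simp: eventually_sequentially)
  define \<mu> where "\<mu> = real n *\<^sub>R (y - blinfun_apply A (u n))"
  have "\<mu> \<bullet> blinfun_apply A (u n) - \<mu> \<bullet> y = - (real n * (r (u n))\<^sup>2)"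
    unfolding \<mu>_def r_def power2_norm_eq_inner
    by (simp add: algebra_simps inner_commute)
  moreover have "0 \<le> real n / 2 * (r (u n))\<^sup>2" by simp
  ultimately have "conj_fun (adj A \<mu>) \<le> \<mu> \<bullet> y - m n"
    using dual[of n, folded \<mu>_def] unfolding m_def by linarith
  with n have "conj_fun (adj A \<mu>) \<le> \<mu> \<bullet> y - f xd + \<epsilon>" by linarith
  then show ?thesis by blast
qed

end

section \<open>From extended real functionals to their finite part\<close>

lemma closed_strongly_convex_finite_part:
  fixes R :: "'a::banach \<Rightarrow> ereal"
  assumes proper: "proper_fun R" and lsc: "lower_semicontinuous R"
    and "0 < c" and conv: "strongly_convex c R"
  shows "closed_strongly_convex (dom_fun R) (\<lambda>x. real_of_ereal (R x)) c"
proof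
  show "dom_fun R \<noteq> {}" using proper by (simp add: proper_fun_def)
  have epi: "z \<in> dom_fun R \<and> real_of_ereal (R z) \<le> m \<longleftrightarrow> R z \<le> ereal m" for z m
    using proper by (cases "R z") (auto simp: dom_fun_def proper_fun_def)
  show "closed {(z, m). z \<in> dom_fun R \<and> real_of_ereal (R z) \<le> m}"
    unfolding epi closed_sequential_limits
  proof (intro allI impI, elim conjE)
    fix u :: "nat \<Rightarrow> 'a \<times> real" and p
    assume u: "\<forall>n. u n \<in> {(z, m). R z \<le> ereal m}" and lim: "u \<longlonglongrightarrow> p"
    obtain z m where p: "p = (z, m)" by fastforce
    have lim1: "(\<lambda>n. fst (u n)) \<longlonglongrightarrow> z" and lim2: "(\<lambda>n. snd (u n)) \<longlonglongrightarrow> m"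
      using tendsto_fst[OF lim] tendsto_snd[OF lim] p by auto
    have "\<not> ereal m < R z"
    proof
      assume "ereal m < R z"
      then obtain b where b: "ereal m < ereal b" "ereal b < R z" using ereal_dense2 by blast
      have "R z \<le> Liminf (at z) R" using lsc by (simp add: lower_semicontinuous_def)
      then have "\<forall>\<^sub>F w in at z. ereal b < R w" using b(2) by (simp add: le_Liminf_iff)
      with b(2) have "\<forall>\<^sub>F w in nhds z. ereal b < R w"
        by (simp add: eventually_nhds_conv_at)
      then have "\<forall>\<^sub>F n in sequentially. ereal b < R (fst (u n))"
        using lim1 by (rule eventually_compose_filterlim)
      moreover have "\<forall>\<^sub>F n in sequentially. snd (u n) < b"
        using order_tendstoD(2)[OF lim2, of b] b(1) by simp
      ultimately have "\<forall>\<^sub>F n in sequentially. False"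
      proof eventually_elim
        case (elim n)
        have "R (fst (u n)) \<le> ereal (snd (u n))" using u by (simp add: case_prod_unfold)
        also have "\<dots> < ereal b" using elim by simp
        finally show ?case using elim by simp
      qed
      then show False by simp
    qed
    then show "p \<in> {(z, m). R z \<le> ereal m}" using p by simp
  qed
next
  fix x x' :: 'a and \<gamma> :: real
  assume *: "x \<in> dom_fun R" "x' \<in> dom_fun R" "0 \<le> \<gamma>" "\<gamma> \<le> 1"
  define w where "w = \<gamma> *\<^sub>R x + (1 - \<gamma>) *\<^sub>R x'"
  obtain a a' where a: "R x = ereal a" "R x' = ereal a'"
    using * proper by (cases "R x"; cases "R x'") (auto simp: dom_fun_def proper_fun_def)
  have le: "R w + ereal (c * \<gamma> * (1 - \<gamma>) * (norm (x - x'))\<^sup>2) \<le> ereal (\<gamma> * a + (1 - \<gamma>) * a')"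
    using conv * unfolding strongly_convex_def w_def by (force simp: a)
  then obtain b where b: "R w = ereal b"
    using proper by (cases "R w") (auto simp: proper_fun_def)
  show "\<gamma> *\<^sub>R x + (1 - \<gamma>) *\<^sub>R x' \<in> dom_fun R \<and>
       real_of_ereal (R (\<gamma> *\<^sub>R x + (1 - \<gamma>) *\<^sub>R x')) + c * \<gamma> * (1 - \<gamma>) * (norm (x - x'))\<^sup>2
         \<le> \<gamma> * real_of_ereal (R x) + (1 - \<gamma>) * real_of_ereal (R x')"
    using le unfolding w_def[symmetric] by (simp add: a b dom_fun_def)
qed (rule \<open>0 < c\<close>)

text \<open>
  The conjugate is finite with the expected derivative; the element representing that derivative is
  unique because functionals separate points.
\<close>
lemma dual_gradient_conjugate:
  fixes R :: "'a::banach \<Rightarrow> ereal"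
  assumes proper: "proper_fun R"
    and "closed_strongly_convex (dom_fun R) (\<lambda>x. real_of_ereal (R x)) c"
  shows "dual_gradient (conjugate R) \<xi>
    = closed_strongly_convex.primal_point (dom_fun R) (\<lambda>x. real_of_ereal (R x)) c \<xi>"
proof -
  interpret closed_strongly_convex "dom_fun R" "\<lambda>x. real_of_ereal (R x)" c by fact
  have fin: "R x = ereal (real_of_ereal (R x))" if "x \<in> dom_fun R" for x
    using that proper by (cases "R x") (auto simp: dom_fun_def proper_fun_def)
  have "conjugate R \<eta> = ereal (conj_fun \<eta>)" for \<eta>
    unfolding conjugate_def
  proof (rule antisym)
    show "(SUP x. ereal (blinfun_apply \<eta> x) - R x) \<le> ereal (conj_fun \<eta>)"
    proof (rule SUP_least)
      fix x
      show "ereal (blinfun_apply \<eta> x) - R x \<le> ereal (conj_fun \<eta>)"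
      proof (cases "x \<in> dom_fun R")
        case True
        then show ?thesis using fenchel_young[OF True, of \<eta>] by (subst fin) auto
      qed (simp add: dom_fun_def)
    qed
    have "ereal (conj_fun \<eta>) = ereal (blinfun_apply \<eta> (primal_point \<eta>)) - R (primal_point \<eta>)"
      by (subst fin[OF primal_point_in]) (simp add: conj_fun_def)
    also have "\<dots> \<le> (SUP x. ereal (blinfun_apply \<eta> x) - R x)" by (rule SUP_upper) simp
    finally show "ereal (conj_fun \<eta>) \<le> (SUP x. ereal (blinfun_apply \<eta> x) - R x)" .
  qed
  then have eq: "(\<lambda>\<eta>. real_of_ereal (conjugate R \<eta>)) = conj_fun" by auto
  show ?thesis
    unfolding dual_gradient_def eq
  proof (rule the_equality)
    show "(conj_fun has_derivative (\<lambda>\<eta>. blinfun_apply \<eta> (primal_point \<xi>))) (at \<xi>)"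
      by (rule conj_fun_has_derivative)
    fix x assume "(conj_fun has_derivative (\<lambda>\<eta>. blinfun_apply \<eta> x)) (at \<xi>)"
    then have "(\<lambda>\<eta> :: 'a \<Rightarrow>\<^sub>L real. blinfun_apply \<eta> x) = (\<lambda>\<eta>. blinfun_apply \<eta> (primal_point \<xi>))"
      by (rule has_derivative_unique[OF _ conj_fun_has_derivative[of \<xi>]])
    then have "blinfun_apply \<eta> (x - primal_point \<xi>) = 0" for \<eta> :: "'a \<Rightarrow>\<^sub>L real"
      by (simp add: blinfun.diff_right fun_eq_iff)
    then show "x = primal_point \<xi>" using blinfun_separates[of "x - primal_point \<xi>"] by auto
  qed
qed

section \<open>Estimates along the dual gradient flow\<close>

text \<open>
  The gradient flow with the relation between the two components available at time \<open>0\<close> too, where it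
  holds by continuity.
\<close>
locale dual_flow = closed_strongly_convex D f c
  for D :: "'a::banach set" and f :: "'a \<Rightarrow> real" and c :: real +
  fixes A :: "'a \<Rightarrow>\<^sub>L 'b::real_inner" and v :: 'b
    and x :: "real \<Rightarrow> 'a" and lam :: "real \<Rightarrow> 'b"
  assumes lam_zero: "lam 0 = 0"
    and continuous_lam: "continuous_on {0..} lam"
    and x_eq: "\<And>t. 0 \<le> t \<Longrightarrow> x t = primal_point (adj A (lam t))"
    and lam_deriv: "\<And>t. 0 < t \<Longrightarrow> (lam has_vector_derivative (v - blinfun_apply A (x t))) (at t)"
begin

definition dual_energy :: "'b \<Rightarrow> real" where
  "dual_energy \<mu> = conj_fun (adj A \<mu>) - \<mu> \<bullet> v"

lemma dual_energy_has_derivative: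
  "(dual_energy has_derivative
     (\<lambda>\<mu>'. \<mu>' \<bullet> (blinfun_apply A (primal_point (adj A \<mu>)) - v))) (at \<mu>)"
proof -
  have "((\<lambda>\<mu>. conj_fun (adj A \<mu>)) has_derivative
      (\<lambda>\<mu>'. blinfun_apply (adj A \<mu>') (primal_point (adj A \<mu>)))) (at \<mu>)"
    using bounded_linear_imp_has_derivative[OF bounded_linear_adj] conj_fun_has_derivative
    by (rule has_derivative_compose)
  then have "((\<lambda>\<mu>. conj_fun (adj A \<mu>) - \<mu> \<bullet> v) has_derivative
      (\<lambda>\<mu>'. blinfun_apply (adj A \<mu>') (primal_point (adj A \<mu>)) - \<mu>' \<bullet> v)) (at \<mu>)"
    by (auto intro!: derivative_eq_intros)
  then show ?thesis by (simp add: dual_energy_def[abs_def] inner_diff_right)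
qed

lemma dual_energy_convex:
  "0 \<le> t \<Longrightarrow> dual_energy (lam t) + (\<mu> - lam t) \<bullet> (blinfun_apply A (x t) - v) \<le> dual_energy \<mu>"
  using conj_fun_subgradient[of "adj A (lam t)" "adj A \<mu>"]
  by (simp add: dual_energy_def x_eq blinfun.diff_left inner_diff_left inner_diff_right)

text \<open>
  The gradient of the dual energy at \<open>lam t\<close> is \<open>A (x t) - v\<close>, so the flow is its gradient flow.
\<close>
lemma dual_energy_dissipation:
  assumes t: "0 < t"
  shows "((\<lambda>t. dual_energy (lam t)) has_real_derivative
           - (norm (blinfun_apply A (x t) - v))\<^sup>2) (at t)"
proof -
  have "((\<lambda>t. dual_energy (lam t)) has_derivative
      (\<lambda>h. (h *\<^sub>R (v - blinfun_apply A (x t)))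
        \<bullet> (blinfun_apply A (primal_point (adj A (lam t))) - v))) (at t)"
    using lam_deriv[OF t, unfolded has_vector_derivative_def] dual_energy_has_derivative
    by (rule has_derivative_compose)
  moreover have "(v - blinfun_apply A (x t)) \<bullet> (blinfun_apply A (x t) - v)
      = - (norm (blinfun_apply A (x t) - v))\<^sup>2"
    by (simp add: power2_norm_eq_inner inner_diff_left inner_diff_right)
  ultimately show ?thesis
    unfolding has_field_derivative_def
    by (elim has_derivative_eq_rhs) (use t in \<open>auto simp: fun_eq_iff x_eq[symmetric]\<close>)
qed

text \<open>
  The Lyapunov function \<open>2 s (E(\<lambda>(s)) - E(\<mu>)) + \<parallel>\<lambda>(s) - \<mu>\<parallel>\<^sup>2\<close> of a convex gradient flow decreases at
  least at the rate \<open>2 s \<parallel>A x(s) - v\<parallel>\<^sup>2\<close>. A lower bound \<open>\<rho>\<close> for the squared residual therefore leaves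
  room for the additional term \<open>s\<^sup>2 \<rho>\<close>.
\<close>
lemma lyapunov_estimate:
  assumes T: "0 \<le> T"
    and \<rho>: "\<And>s. 0 < s \<Longrightarrow> s < T \<Longrightarrow> \<rho> \<le> (norm (blinfun_apply A (x s) - v))\<^sup>2"
  shows "T\<^sup>2 * \<rho> + 2 * T * (dual_energy (lam T) - dual_energy \<mu>) + (norm (lam T - \<mu>))\<^sup>2
           \<le> (norm \<mu>)\<^sup>2"
proof -
  define \<psi> where "\<psi> s = s\<^sup>2 * \<rho> + 2 * s * (dual_energy (lam s) - dual_energy \<mu>)
    + (lam s - \<mu>) \<bullet> (lam s - \<mu>)" for s
  have "\<psi> T \<le> \<psi> 0"
  proof (rule DERIV_nonpos_imp_decreasing_open[OF T])
    have "continuous_on {0..T} lam" using continuous_lam by (rule continuous_on_subset) auto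
    moreover have "continuous_on UNIV dual_energy"
      using has_derivative_continuous[OF dual_energy_has_derivative]
      by (auto intro!: continuous_at_imp_continuous_on)
    ultimately show "continuous_on {0..T} \<psi>"
      unfolding \<psi>_def by (intro continuous_intros) (auto intro: continuous_on_compose2)
  next
    fix s assume s: "0 < s" "s < T"
    define g where "g = blinfun_apply A (x s) - v"
    have E: "((\<lambda>t. dual_energy (lam t)) has_real_derivative - (norm g)\<^sup>2) (at s)"
      unfolding g_def by (rule dual_energy_dissipation[OF s(1)])
    have l: "(lam has_derivative (\<lambda>h. h *\<^sub>R (- g))) (at s)"
      using lam_deriv[OF s(1)] by (simp add: has_vector_derivative_def g_def)
    have "((\<lambda>s. (lam s - \<mu>) \<bullet> (lam s - \<mu>)) has_derivative
        (\<lambda>h. (lam s - \<mu>) \<bullet> (h *\<^sub>R (- g) - 0) + (h *\<^sub>R (- g) - 0) \<bullet> (lam s - \<mu>))) (at s)"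
      by (intro has_derivative_inner has_derivative_diff l has_derivative_const)
    then have sq: "((\<lambda>s. (lam s - \<mu>) \<bullet> (lam s - \<mu>)) has_real_derivative
        2 * ((\<mu> - lam s) \<bullet> g)) (at s)"
      unfolding has_field_derivative_def
      by (rule has_derivative_eq_rhs)
        (auto simp: fun_eq_iff inner_diff_left inner_diff_right inner_commute algebra_simps)
    have "(\<psi> has_real_derivative 2 * s * \<rho> + (2 * (dual_energy (lam s) - dual_energy \<mu>)
        + 2 * s * (- (norm g)\<^sup>2)) + 2 * ((\<mu> - lam s) \<bullet> g)) (at s)"
      unfolding \<psi>_def[abs_def] by (rule derivative_eq_intros E sq refl | simp)+
    moreover have "s * \<rho> \<le> s * (norm g)\<^sup>2"
      using \<rho>[OF s] s by (intro mult_left_mono) (auto simp: g_def)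
    moreover have "dual_energy (lam s) + (\<mu> - lam s) \<bullet> g \<le> dual_energy \<mu>"
      unfolding g_def using s by (intro dual_energy_convex) auto
    ultimately show "\<exists>d. (\<psi> has_real_derivative d) (at s) \<and> d \<le> 0"
      by (intro exI[of _ "2 * s * \<rho> + (2 * (dual_energy (lam s) - dual_energy \<mu>)
        + 2 * s * (- (norm g)\<^sup>2)) + 2 * ((\<mu> - lam s) \<bullet> g)"]) (simp add: algebra_simps)
  qed
  then show ?thesis by (simp add: \<psi>_def lam_zero power2_norm_eq_inner)
qed

text \<open>
  The multiplier \<open>\<mu>\<close> is almost optimal for the exact datum \<open>y\<close>, while the energy belongs to the noisy
  datum \<open>v\<close>. Weak duality bounds the energy along the flow from below, and the change of datum
  costs \<open>\<parallel>\<lambda>(T) - \<mu>\<parallel> \<parallel>v - y\<parallel>\<close>.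
\<close>
lemma almost_optimal_estimate:
  assumes T: "0 \<le> T"
    and \<rho>: "\<And>s. 0 < s \<Longrightarrow> s < T \<Longrightarrow> \<rho> \<le> (norm (blinfun_apply A (x s) - v))\<^sup>2"
    and xd: "xd \<in> D" "blinfun_apply A xd = y"
    and gap: "conj_fun (adj A \<mu>) \<le> \<mu> \<bullet> y - f xd + \<epsilon>"
  shows "T\<^sup>2 * \<rho> + (norm (lam T - \<mu>))\<^sup>2
           \<le> (norm \<mu>)\<^sup>2 + 2 * T * (\<epsilon> + norm (lam T - \<mu>) * norm (v - y))"
proof -
  have "lam T \<bullet> y - f xd \<le> conj_fun (adj A (lam T))"
    using weak_duality[OF xd(1), of "lam T" A] by (simp add: xd(2))
  then have "- \<epsilon> - (lam T - \<mu>) \<bullet> (v - y) \<le> dual_energy (lam T) - dual_energy \<mu>"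
    using gap by (simp add: dual_energy_def inner_diff_left inner_diff_right)
  moreover have "(lam T - \<mu>) \<bullet> (v - y) \<le> norm (lam T - \<mu>) * norm (v - y)"
    by (rule norm_cauchy_schwarz)
  ultimately have "- (\<epsilon> + norm (lam T - \<mu>) * norm (v - y)) \<le> dual_energy (lam T) - dual_energy \<mu>"
    by linarith
  then have "2 * T * - (\<epsilon> + norm (lam T - \<mu>) * norm (v - y))
      \<le> 2 * T * (dual_energy (lam T) - dual_energy \<mu>)"
    using T by (intro mult_left_mono) auto
  then show ?thesis using lyapunov_estimate[OF T \<rho>, of \<mu>] by (simp add: algebra_simps)
qed

text \<open>
  The term \<open>2 T \<parallel>\<lambda>(T) - \<mu>\<parallel> \<parallel>v - y\<parallel>\<close> is absorbed into \<open>\<parallel>\<lambda>(T) - \<mu>\<parallel>\<^sup>2\<close>.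
\<close>
lemma residual_bound:
  assumes "0 \<le> T"
    and "\<And>s. 0 < s \<Longrightarrow> s < T \<Longrightarrow> \<rho> \<le> (norm (blinfun_apply A (x s) - v))\<^sup>2"
    and "xd \<in> D" "blinfun_apply A xd = y"
    and "conj_fun (adj A \<mu>) \<le> \<mu> \<bullet> y - f xd + \<epsilon>"
  shows "T\<^sup>2 * \<rho> \<le> (norm \<mu>)\<^sup>2 + 2 * T * \<epsilon> + T\<^sup>2 * (norm (v - y))\<^sup>2"
proof -
  have "0 \<le> (norm (lam T - \<mu>) - T * norm (v - y))\<^sup>2" by simp
  then show ?thesis
    using almost_optimal_estimate[OF assms] by (simp add: power2_eq_square algebra_simps)
qed

text \<open>
  With \<open>\<rho> = 0\<close> and only half of \<open>\<parallel>\<lambda>(T) - \<mu>\<parallel>\<^sup>2\<close> spent on absorbing the noise term, the other half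
  bounds the multiplier.
\<close>
lemma multiplier_bound:
  assumes T: "0 \<le> T" and xd: "xd \<in> D" "blinfun_apply A xd = y"
    and gap: "conj_fun (adj A \<mu>) \<le> \<mu> \<bullet> y - f xd + \<epsilon>"
  shows "(norm (lam T))\<^sup>2 \<le> 6 * (norm \<mu>)\<^sup>2 + 8 * T * \<epsilon> + 8 * T\<^sup>2 * (norm (v - y))\<^sup>2"
proof -
  define q \<delta> where "q = norm (lam T - \<mu>)" and "\<delta> = norm (v - y)"
  have "q\<^sup>2 \<le> (norm \<mu>)\<^sup>2 + 2 * T * (\<epsilon> + q * \<delta>)"
    using almost_optimal_estimate[OF T _ xd gap, of 0] by (simp add: q_def \<delta>_def)
  moreover have "0 \<le> (q - 2 * T * \<delta>)\<^sup>2" by simp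
  ultimately have q: "q\<^sup>2 \<le> 2 * (norm \<mu>)\<^sup>2 + 4 * T * \<epsilon> + 4 * T\<^sup>2 * \<delta>\<^sup>2"
    by (simp add: power2_eq_square algebra_simps)
  have "norm (lam T) \<le> q + norm \<mu>"
    unfolding q_def using norm_triangle_ineq[of "lam T - \<mu>" \<mu>] by simp
  then have "(norm (lam T))\<^sup>2 \<le> (q + norm \<mu>)\<^sup>2" by (intro power_mono) auto
  also have "\<dots> \<le> 2 * q\<^sup>2 + 2 * (norm \<mu>)\<^sup>2"
    using zero_le_power2[of "q - norm \<mu>"] by (simp add: power2_eq_square algebra_simps)
  finally show ?thesis using q by (simp add: \<delta>_def)
qed

end

lemma dual_flow_of_gradient_flow:
  fixes R :: "'a::banach \<Rightarrow> ereal"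
  assumes proper: "proper_fun R"
    and csc: "closed_strongly_convex (dom_fun R) (\<lambda>x. real_of_ereal (R x)) c"
    and flow: "dual_gradient_flow A R v x lam" and zero: "lam 0 = 0"
  shows "dual_flow (dom_fun R) (\<lambda>x. real_of_ereal (R x)) c A v x lam"
proof -
  interpret closed_strongly_convex "dom_fun R" "\<lambda>x. real_of_ereal (R x)" c by fact
  have x_cont: "continuous_on {0..} x"
    and x_pos: "\<And>t. 0 < t \<Longrightarrow> x t = primal_point (adj A (lam t))"
    and deriv: "\<And>t. 0 < t \<Longrightarrow> (lam has_vector_derivative (v - blinfun_apply A (x t))) (at t)"
    and lam_cont: "continuous_on {0..} lam"
    using flow unfolding dual_gradient_flow_def C1_half_line_def
    by (auto simp: dual_gradient_conjugate[OF proper csc] continuous_on_eq_continuous_within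
        intro: has_vector_derivative_continuous)
  have adj_cont: "continuous_on S (adj A)" for S
    by (rule linear_continuous_on[OF bounded_linear_adj])
  have "continuous_on {0..} (\<lambda>t. primal_point (adj A (lam t)))"
    by (intro continuous_on_compose2[OF continuous_on_primal_point[of UNIV]]
        continuous_on_compose2[OF adj_cont[of UNIV]] lam_cont) auto
  then have "((\<lambda>t. primal_point (adj A (lam t))) \<longlongrightarrow> primal_point (adj A (lam 0))) (at_right 0)"
    by (auto simp: continuous_on_def intro: tendsto_within_subset)
  moreover have "\<forall>\<^sub>F t in at_right 0. primal_point (adj A (lam t)) = x t"
    using x_pos by (auto simp: eventually_at_right_field intro!: exI[of _ 1])
  ultimately have "(x \<longlongrightarrow> primal_point (adj A (lam 0))) (at_right 0)"
    by (rule Lim_transform_eventually)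
  moreover have "(x \<longlongrightarrow> x 0) (at_right 0)"
    using x_cont by (auto simp: continuous_on_def intro: tendsto_within_subset)
  ultimately have "x 0 = primal_point (adj A (lam 0))"
    using tendsto_unique trivial_limit_at_right_real by blast
  then show ?thesis
    using x_pos deriv zero lam_cont by unfold_locales (auto simp: le_less)
qed

section \<open>Convergence of the heuristic stopping rule\<close>

lemma tendsto_zero_squeeze:
  fixes g h :: "'i \<Rightarrow> real"
  assumes "(h \<longlongrightarrow> 0) F" "\<And>i. 0 \<le> g i" "\<And>i. g i \<le> h i"
  shows "(g \<longlongrightarrow> 0) F"
  by (rule tendsto_sandwich[where f = "\<lambda>_. 0" and h = h]) (use assms in simp_all)

theorem theorem2p11:
  fixes A :: "'a::banach \<Rightarrow>\<^sub>L 'b::{real_inner, complete_space}"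
    and R :: "'a \<Rightarrow> ereal"
    and c0 \<kappa> a :: real
    and y :: 'b
    and xd :: 'a
    and F :: "'i filter"
    and yd :: "'i \<Rightarrow> 'b"
    and x :: "'i \<Rightarrow> real \<Rightarrow> 'a"
    and lam :: "'i \<Rightarrow> real \<Rightarrow> 'b"
    and ts :: "'i \<Rightarrow> real"
  assumes "proper_fun R"
    and "lower_semicontinuous R"
    and "c0 > 0"
    and "strongly_convex c0 R"
    and "\<And>c::real. compactin weak_topology {z. R z \<le> ereal c}"
    and "\<exists>z\<in>dom_fun R. blinfun_apply A z = y"
    and "is_arg_min R (\<lambda>z. blinfun_apply A z = y) xd"
    and "\<And>i. norm (yd i - y) > 0"
    and "((\<lambda>i. norm (yd i - y)) \<longlongrightarrow> 0) F"
    and "\<And>i. dual_gradient_flow A R (yd i) (x i) (lam i)"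
    and "\<And>i. lam i 0 = 0"
    and "\<kappa> > 0"
    and "\<And>i z. z \<in> x i ` {0..} \<Longrightarrow> norm (yd i - blinfun_apply A z) \<ge> \<kappa> * norm (yd i - y)"
    and "a > 0"
    and "\<And>i. is_arg_min (\<lambda>t. (t + a) * (norm (blinfun_apply A (x i t) - yd i))\<^sup>2)
                         (\<lambda>t. t \<ge> 0) (ts i)"
  shows "((\<lambda>i. R (x i (ts i))) \<longlongrightarrow> R xd) F
       \<and> ((\<lambda>i. bregman R (adj A (lam i (ts i))) xd (x i (ts i))) \<longlongrightarrow> 0) F
       \<and> ((\<lambda>i. norm (x i (ts i) - xd)) \<longlongrightarrow> 0) F"
proof -
  define f where "f z = real_of_ereal (R z)" for z
  define \<delta> where "\<delta> i = norm (yd i - y)" for i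
  define r where "r i = norm (blinfun_apply A (x i (ts i)) - yd i)" for i
  define \<Theta> where "\<Theta> i = (ts i + a) * (r i)\<^sup>2" for i
  define X where "X i = x i (ts i)" for i
  define L where "L i = lam i (ts i)" for i
  have csc: "closed_strongly_convex (dom_fun R) (\<lambda>z. real_of_ereal (R z)) c0"
    by (rule closed_strongly_convex_finite_part) fact+
  interpret closed_strongly_convex "dom_fun R" f c0
    using csc by (simp add: f_def[abs_def])
  have flow: "dual_flow (dom_fun R) f c0 A (yd i) (x i) (lam i)" for i
    using dual_flow_of_gradient_flow[OF assms(1) csc assms(10,11)] by (simp add: f_def[abs_def])
  have fin: "R z = ereal (f z)" if "z \<in> dom_fun R" for z
    using that assms(1) by (cases "R z") (auto simp: dom_fun_def proper_fun_def f_def)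
  have A_xd: "blinfun_apply A xd = y"
    and xd_le: "\<And>z. blinfun_apply A z = y \<Longrightarrow> R xd \<le> R z"
    using assms(7) by (auto simp: is_arg_min_def not_less)
  have xd: "xd \<in> dom_fun R"
    using assms(6) xd_le by (auto simp: dom_fun_def intro: le_less_trans)
  have xd_min: "f xd \<le> f z" if "z \<in> dom_fun R" "blinfun_apply A z = y" for z
    using xd_le[OF that(2)] by (simp add: fin xd that(1))
  have gap: "\<exists>\<mu>. conj_fun (adj A \<mu>) \<le> \<mu> \<bullet> y - f xd + \<epsilon>" if "0 < \<epsilon>" for \<epsilon>
    using no_duality_gap[OF xd A_xd xd_min that] by blast
  have ts: "0 \<le> ts i"
    and \<Theta>_min: "\<And>t. 0 \<le> t \<Longrightarrow> \<Theta> i \<le> (t + a) * (norm (blinfun_apply A (x i t) - yd i))\<^sup>2" for i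
    using assms(15)[of i] by (auto simp: is_arg_min_def not_less \<Theta>_def r_def)
  have X_eq: "X i = primal_point (adj A (L i))" for i
    unfolding X_def L_def using dual_flow.x_eq[OF flow ts] .
  have X_in: "X i \<in> dom_fun R" for i unfolding X_eq by (rule primal_point_in)
  have \<delta>: "(\<delta> \<longlongrightarrow> 0) F" using assms(9) by (simp add: \<delta>_def[abs_def])

  have \<Theta>_nonneg: "0 \<le> \<Theta> i" for i using ts[of i] \<open>a > 0\<close> by (simp add: \<Theta>_def)
  \<comment> \<open>For \<open>s < T\<close> and \<open>a \<le> T\<close> minimality of \<open>\<Theta> i\<close> bounds the squared residual at \<open>s\<close> from below by \<open>\<Theta> i / (2 T)\<close>.\<close>
  have \<Theta>_le: "\<Theta> i \<le> 2 * (norm \<mu>)\<^sup>2 / T + 4 * \<epsilon> + 2 * T * (\<delta> i)\<^sup>2"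
    if T: "a \<le> T" and \<mu>: "conj_fun (adj A \<mu>) \<le> \<mu> \<bullet> y - f xd + \<epsilon>" for i T \<mu> \<epsilon>
  proof -
    have T0: "0 < T" using T \<open>a > 0\<close> by simp
    have "\<Theta> i / (2 * T) \<le> (norm (blinfun_apply A (x i s) - yd i))\<^sup>2" if s: "0 < s" "s < T" for s
    proof -
      have "\<Theta> i \<le> (s + a) * (norm (blinfun_apply A (x i s) - yd i))\<^sup>2" using \<Theta>_min s by simp
      also have "\<dots> \<le> (2 * T) * (norm (blinfun_apply A (x i s) - yd i))\<^sup>2"
        using s T by (intro mult_right_mono) auto
      finally show ?thesis using T0 by (simp add: field_simps)
    qed
    then have "T\<^sup>2 * (\<Theta> i / (2 * T)) \<le> (norm \<mu>)\<^sup>2 + 2 * T * \<epsilon> + T\<^sup>2 * (\<delta> i)\<^sup>2"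
      unfolding \<delta>_def using T0
      by (intro dual_flow.residual_bound[OF flow _ _ xd A_xd \<mu>]) auto
    then show ?thesis using T0 by (simp add: field_simps power2_eq_square)
  qed
  have \<Theta>: "(\<Theta> \<longlongrightarrow> 0) F"
  proof (rule order_tendstoI)
    fix e :: real assume e: "0 < e"
    obtain \<mu> where \<mu>: "conj_fun (adj A \<mu>) \<le> \<mu> \<bullet> y - f xd + e / 8" using gap[of "e / 8"] e by auto
    \<comment> \<open>The three terms of the bound become at most \<open>e / 4\<close>, exactly \<open>e / 2\<close>, and eventually negligible.\<close>
    define T where "T = a + 8 * (norm \<mu>)\<^sup>2 / e"
    have T: "a \<le> T" "0 < T" using e \<open>a > 0\<close> by (auto simp: T_def add_pos_nonneg)
    have "8 * (norm \<mu>)\<^sup>2 \<le> e * T" using e \<open>a > 0\<close> by (simp add: T_def field_simps)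
    then have "2 * (norm \<mu>)\<^sup>2 / T \<le> e / 4" using T e by (simp add: field_simps)
    then have less: "2 * (norm \<mu>)\<^sup>2 / T + 4 * (e / 8) + 2 * T * 0\<^sup>2 < e" using e by simp
    have "((\<lambda>i. 2 * (norm \<mu>)\<^sup>2 / T + 4 * (e / 8) + 2 * T * (\<delta> i)\<^sup>2)
        \<longlongrightarrow> 2 * (norm \<mu>)\<^sup>2 / T + 4 * (e / 8) + 2 * T * 0\<^sup>2) F"
      by (intro tendsto_add tendsto_const tendsto_mult tendsto_power \<delta>)
    then have "\<forall>\<^sub>F i in F. 2 * (norm \<mu>)\<^sup>2 / T + 4 * (e / 8) + 2 * T * (\<delta> i)\<^sup>2 < e"
      using less by (rule order_tendstoD(2))
    then show "\<forall>\<^sub>F i in F. \<Theta> i < e"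
      by (rule eventually_mono) (rule le_less_trans[OF \<Theta>_le[OF T(1) \<mu>]])
  next
    fix b :: real assume "b < 0"
    then show "\<forall>\<^sub>F i in F. b < \<Theta> i" by (intro always_eventually allI less_le_trans[OF _ \<Theta>_nonneg])
  qed

  \<comment> \<open>The noise condition makes the stopping time, the noise level and the residual jointly small.\<close>
  define e where "e i = (ts i + a) * (\<delta> i + r i)\<^sup>2" for i
  have \<kappa>\<delta>: "\<kappa> * \<delta> i \<le> r i" for i
    using assms(13)[of "x i (ts i)" i] ts[of i] by (simp add: \<delta>_def r_def norm_minus_commute)
  have e_le: "e i \<le> (1 / \<kappa> + 1)\<^sup>2 * \<Theta> i" for i
  proof -
    have "\<delta> i + r i \<le> (1 / \<kappa> + 1) * r i"
      using \<kappa>\<delta>[of i] \<open>\<kappa> > 0\<close> by (simp add: field_simps)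
    then have "(\<delta> i + r i)\<^sup>2 \<le> ((1 / \<kappa> + 1) * r i)\<^sup>2"
      by (intro power_mono) (auto simp: \<delta>_def r_def)
    then have "e i \<le> (ts i + a) * ((1 / \<kappa> + 1) * r i)\<^sup>2"
      unfolding e_def using ts[of i] \<open>a > 0\<close> by (intro mult_left_mono) auto
    then show ?thesis by (simp add: \<Theta>_def power_mult_distrib mult_ac)
  qed
  have e_nonneg: "0 \<le> e i" for i using ts[of i] \<open>a > 0\<close> by (simp add: e_def)
  have e: "(e \<longlongrightarrow> 0) F"
    using tendsto_mult_right_zero[OF \<Theta>, of "(1 / \<kappa> + 1)\<^sup>2"] e_nonneg e_le
    by (rule tendsto_zero_squeeze)
  have sq_le: "(\<delta> i + r i)\<^sup>2 \<le> e i / a" for i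
    using ts[of i] \<open>a > 0\<close> by (simp add: e_def field_simps)
  have nonneg: "0 \<le> \<delta> i" "0 \<le> r i" for i by (auto simp: \<delta>_def r_def)

  have res: "norm (y - blinfun_apply A (X i)) \<le> \<delta> i + r i" for i
    using norm_triangle_ineq[of "y - yd i" "yd i - blinfun_apply A (X i)"]
    by (simp add: \<delta>_def r_def X_def norm_minus_commute)

  \<comment> \<open>Here \<open>a > 0\<close> matters: the factor \<open>ts i + a\<close> stays away from zero even if the stopping times do not.\<close>
  have err: "((\<lambda>i. \<delta> i + r i) \<longlongrightarrow> 0) F"
  proof -
    have "((\<lambda>i. (\<delta> i + r i)\<^sup>2) \<longlongrightarrow> 0) F"
      using tendsto_divide_zero[OF e, of a] zero_le_power2 sq_le by (rule tendsto_zero_squeeze)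
    then show ?thesis by simp
  qed

  \<comment> \<open>The multipliers may be unbounded, but grow slowly enough; any fixed \<open>\<mu>\<close> with gap \<open>1\<close> serves for comparison.\<close>
  have pairing: "((\<lambda>i. norm (L i) * (\<delta> i + r i)) \<longlongrightarrow> 0) F"
  proof -
    obtain \<mu> where \<mu>: "conj_fun (adj A \<mu>) \<le> \<mu> \<bullet> y - f xd + 1" using gap[of 1] by auto
    have "(norm (L i) * (\<delta> i + r i))\<^sup>2
        \<le> 6 * (norm \<mu>)\<^sup>2 * (\<delta> i + r i)\<^sup>2 + 8 * e i + 8 * (e i)\<^sup>2" for i
    proof -
      define s where "s = (\<delta> i + r i)\<^sup>2"
      have "0 \<le> s" by (simp add: s_def)
      have ts_s: "ts i * s \<le> e i" unfolding e_def s_def[symmetric]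
        using \<open>a > 0\<close> \<open>0 \<le> s\<close> by (simp add: algebra_simps)
      have "(\<delta> i)\<^sup>2 \<le> s" unfolding s_def using nonneg[of i] by (intro power_mono) auto
      then have "ts i * (\<delta> i)\<^sup>2 \<le> e i" by (rule order_trans[OF mult_left_mono[OF _ ts] ts_s])
      then have "(ts i * (\<delta> i)\<^sup>2) * (ts i * s) \<le> e i * e i"
        using ts_s ts[of i] \<open>0 \<le> s\<close> e_nonneg[of i] by (intro mult_mono) auto
      then have *: "(ts i)\<^sup>2 * (\<delta> i)\<^sup>2 * s \<le> (e i)\<^sup>2" by (simp add: power2_eq_square mult_ac)
      have "(norm (L i))\<^sup>2 \<le> 6 * (norm \<mu>)\<^sup>2 + 8 * ts i * 1 + 8 * (ts i)\<^sup>2 * (\<delta> i)\<^sup>2"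
        unfolding L_def \<delta>_def by (rule dual_flow.multiplier_bound[OF flow ts xd A_xd \<mu>])
      then have "(norm (L i))\<^sup>2 * s \<le> (6 * (norm \<mu>)\<^sup>2 + 8 * ts i * 1 + 8 * (ts i)\<^sup>2 * (\<delta> i)\<^sup>2) * s"
        using \<open>0 \<le> s\<close> by (rule mult_right_mono)
      also have "\<dots> = 6 * (norm \<mu>)\<^sup>2 * s + 8 * (ts i * s) + 8 * ((ts i)\<^sup>2 * (\<delta> i)\<^sup>2 * s)"
        by (simp add: algebra_simps)
      also have "\<dots> \<le> 6 * (norm \<mu>)\<^sup>2 * s + 8 * e i + 8 * (e i)\<^sup>2"
        using ts_s * by linarith
      finally show ?thesis by (simp add: s_def power_mult_distrib)
    qed
    note bound = this
    have "((\<lambda>i. 6 * (norm \<mu>)\<^sup>2 * (\<delta> i + r i)\<^sup>2 + 8 * e i + 8 * (e i)\<^sup>2)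
        \<longlongrightarrow> 6 * (norm \<mu>)\<^sup>2 * 0\<^sup>2 + 8 * 0 + 8 * 0\<^sup>2) F"
      by (intro tendsto_add tendsto_const tendsto_mult tendsto_power err e)
    then have "((\<lambda>i. 6 * (norm \<mu>)\<^sup>2 * (\<delta> i + r i)\<^sup>2 + 8 * e i + 8 * (e i)\<^sup>2) \<longlongrightarrow> 0) F"
      by simp
    then have "((\<lambda>i. (norm (L i) * (\<delta> i + r i))\<^sup>2) \<longlongrightarrow> 0) F"
      using zero_le_power2 bound by (rule tendsto_zero_squeeze)
    then show ?thesis by simp
  qed

  \<comment> \<open>The pairing is the difference between the gap of the functional values and the Bregman distance \<open>d\<close>.\<close>
  have pair_le: "\<bar>L i \<bullet> (y - blinfun_apply A (X i))\<bar> \<le> norm (L i) * (\<delta> i + r i)" for i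
  proof -
    have "\<bar>L i \<bullet> (y - blinfun_apply A (X i))\<bar> \<le> norm (L i) * norm (y - blinfun_apply A (X i))"
      by (rule Cauchy_Schwarz_ineq2)
    also have "\<dots> \<le> norm (L i) * (\<delta> i + r i)" using res by (intro mult_left_mono) auto
    finally show ?thesis .
  qed
  have pair0: "((\<lambda>i. L i \<bullet> (y - blinfun_apply A (X i))) \<longlongrightarrow> 0) F"
    by (rule Lim_null_comparison[OF _ pairing]) (use pair_le in simp)
  define d where "d i = f xd - f (X i) - L i \<bullet> (y - blinfun_apply A (X i))" for i
  have growth: "c0 * (norm (xd - X i))\<^sup>2 \<le> d i" for i
    using primal_point_growth[OF xd, of "adj A (L i)"]
    by (simp add: d_def X_eq[symmetric] blinfun.diff_right inner_diff_right A_xd)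
  have d_nonneg: "0 \<le> d i" for i
    using growth[of i] mult_nonneg_nonneg[OF less_imp_le[OF c_pos] zero_le_power2[of "norm (xd - X i)"]]
    by linarith
  have fX: "((\<lambda>i. f (X i)) \<longlongrightarrow> f xd) F"
  proof (rule order_tendstoI)
    fix b assume b: "b < f xd"
    define \<epsilon> where "\<epsilon> = (f xd - b) / 2"
    obtain \<mu> where \<mu>: "conj_fun (adj A \<mu>) \<le> \<mu> \<bullet> y - f xd + \<epsilon>" using gap[of \<epsilon>] b by (auto simp: \<epsilon>_def)
    have lower: "f xd - \<epsilon> - norm \<mu> * (\<delta> i + r i) \<le> f (X i)" for i
    proof -
      have "\<mu> \<bullet> (y - blinfun_apply A (X i)) \<le> norm \<mu> * norm (y - blinfun_apply A (X i))"
        by (rule norm_cauchy_schwarz)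
      also have "\<dots> \<le> norm \<mu> * (\<delta> i + r i)" using res by (intro mult_left_mono) auto
      finally show ?thesis
        using weak_duality[OF X_in, of \<mu> A i] \<mu> by (simp add: inner_diff_right)
    qed
    have "((\<lambda>i. f xd - \<epsilon> - norm \<mu> * (\<delta> i + r i)) \<longlongrightarrow> f xd - \<epsilon> - norm \<mu> * 0) F"
      by (intro tendsto_diff tendsto_mult tendsto_const err)
    moreover have "b < f xd - \<epsilon> - norm \<mu> * 0" using b by (simp add: \<epsilon>_def field_simps)
    ultimately have "\<forall>\<^sub>F i in F. b < f xd - \<epsilon> - norm \<mu> * (\<delta> i + r i)" by (rule order_tendstoD(1))
    then show "\<forall>\<^sub>F i in F. b < f (X i)"
      by (rule eventually_mono) (rule less_le_trans[OF _ lower])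
  next
    fix b assume b: "f xd < b"
    have upper: "f (X i) \<le> f xd - L i \<bullet> (y - blinfun_apply A (X i))" for i
      using d_nonneg[of i] by (simp add: d_def)
    have "((\<lambda>i. f xd - L i \<bullet> (y - blinfun_apply A (X i))) \<longlongrightarrow> f xd - 0) F"
      by (intro tendsto_diff tendsto_const pair0)
    then have "\<forall>\<^sub>F i in F. f xd - L i \<bullet> (y - blinfun_apply A (X i)) < b"
      by (rule order_tendstoD(2)) (use b in simp)
    then show "\<forall>\<^sub>F i in F. f (X i) < b"
      by (rule eventually_mono) (rule le_less_trans[OF upper])
  qed
  have "(d \<longlongrightarrow> f xd - f xd - 0) F"
    unfolding d_def[abs_def] by (intro tendsto_diff tendsto_const fX pair0)
  then have d: "(d \<longlongrightarrow> 0) F" by simp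

  have "((\<lambda>i. R (X i)) \<longlongrightarrow> R xd) F"
    using fX by (simp add: fin X_in xd)
  moreover have "bregman R (adj A (L i)) xd (X i) = ereal (d i)" for i
    by (simp add: bregman_def fin X_in xd d_def blinfun.diff_right inner_diff_right A_xd)
  then have "((\<lambda>i. bregman R (adj A (L i)) xd (X i)) \<longlongrightarrow> 0) F"
    using tendsto_ereal[OF d] by (simp flip: zero_ereal_def)
  moreover have "((\<lambda>i. norm (X i - xd)) \<longlongrightarrow> 0) F"
  proof -
    have "(norm (X i - xd))\<^sup>2 \<le> d i / c0" for i
      using growth[of i] c_pos by (simp add: field_simps norm_minus_commute)
    note bound = this
    have "((\<lambda>i. (norm (X i - xd))\<^sup>2) \<longlongrightarrow> 0) F"
      using tendsto_divide_zero[OF d, of c0] zero_le_power2 bound by (rule tendsto_zero_squeeze)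
    then show ?thesis by simp
  qed
  ultimately show ?thesis by (simp add: X_def L_def)
qed

end
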